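(* Let $T=\{1432,2143,3214\}$ and let $F_T(x)=\sum_{n\ge0}|S_n(T)|x^n$. Then $$F_T(x)=\frac{(1-x)^4(1-6x+12x^2-9x^3+x^4)}{1-11x+51x^2-132x^3+209x^4-208x^5+128x^6-44x^7+5x^8}.$$
   Context: $S_n$ is the set of permutations of $[n]$ ($S_0$ contains the empty permutation). A permutation avoids a pattern $\tau$ if it has no subsequence order-isomorphic to $\tau$; $S_n(T)$ is the set of permutations in $S_n$ avoiding every pattern in $T$. *)

theory Defs
  imports
    "HOL-Combinatorics.Multiset_Permutations"
    "HOL-Library.Sublist"
    "HOL-Computational_Algebra.Formal_Power_Series"
begin

text \<open>
  Permutations of $[n]$ are represented in one-line notation, as the elements of
  \<^term>\<open>permutations_of_set {1..n}\<close>; patterns are words in the same notation.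
  \<^const>\<open>subseq\<close> is the relation of being a (not necessarily contiguous) subsequence.
\<close>

definition order_isomorphic :: "nat list \<Rightarrow> nat list \<Rightarrow> bool" where
  "order_isomorphic xs ys \<longleftrightarrow>
     length xs = length ys \<and>
     (\<forall>i<length xs. \<forall>j<length xs. xs ! i < xs ! j \<longleftrightarrow> ys ! i < ys ! j)"

definition avoids :: "nat list \<Rightarrow> nat list \<Rightarrow> bool" where
  "avoids \<pi> \<tau> \<longleftrightarrow> \<not> (\<exists>\<sigma>. subseq \<sigma> \<pi> \<and> order_isomorphic \<sigma> \<tau>)"

definition avoiders :: "nat \<Rightarrow> nat list set \<Rightarrow> nat list set" where
  "avoiders n T = {\<pi> \<in> permutations_of_set {1..n}. \<forall>\<tau>\<in>T. avoids \<pi> \<tau>}"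

definition avoiders_gf :: "nat list set \<Rightarrow> rat fps" where
  "avoiders_gf T = Abs_fps (\<lambda>n. of_nat (card (avoiders n T)))"

end

theory Submission
  imports Defs
begin

text \<open>
  Build permutations by prepending letters. Whether a further letter may be prepended at a given height
  depends only on the set of heights still allowed (the active gaps) and on two relations between
  heights telling which gaps an insertion makes inactive, and these data determine those of the
  children. Starting from a single letter only six shapes of data occur, each depending on at most
  two numbers of gaps, so the generating tree has explicit succession rules. Their generating functions
  are solved one shape after the other with \<open>lam = 1 / (1 - x)\<close>: along a chain of gaps they form
  geometric progressions with ratio \<open>lam\<close>. The last shape satisfies a functional equation
  in two numbers \<open>a\<close>, \<open>b\<close> whose unique solution is a combination of \<open>lam ^ a\<close>, \<open>lam ^ b\<close> and linear
  terms; its values at \<open>(0, 0)\<close> and \<open>(1, 0)\<close> are found from a linear system of two equations.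
\<close>

section \<open>Prepending a letter\<close>

text \<open>An occurrence created by prepending must start with the new letter, so whether a height
  is allowed is a question about triples of the old permutation. A triple that is new starts with
  the letter prepended last, hence asks about old pairs; a new pair asks about one old letter, and
  since every value up to the length occurs, only the length matters there. This descent from 4 to 1
  is why two relations on heights close up. In both relations \<open>h\<close> is bounded above only
  by \<open>h < c\<close>, so on its side of \<open>k\<close> a gap is killed together with all
  lower ones. Each relation is therefore recorded by one threshold per inserted height, and a shape
  is just the relative order of gaps and thresholds. The obstacle for the generating functions is
  the family \<open>W\<close>: one child of \<open>W a b\<close> has a larger second index, and
  another turns the second index into the first, so no induction over labels terminates. What does
  decrease is the depth, that is, the power of \<open>z\<close>; this gives uniqueness, after which
  it suffices to exhibit a solution.\<close>

definition bad :: "nat \<Rightarrow> nat \<Rightarrow> nat \<Rightarrow> nat \<Rightarrow> bool" where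
  "bad a b c d \<longleftrightarrow> a < d \<and> d < c \<and> c < b \<or> b < a \<and> a < d \<and> d < c \<or> c < b \<and> b < a \<and> a < d"

definition good :: "nat list \<Rightarrow> bool" where
  "good \<pi> \<longleftrightarrow> \<not> (\<exists>a b c d. subseq [a, b, c, d] \<pi> \<and> bad a b c d)"

text \<open>
  Gap \<open>g\<close> lies just above the value \<open>g\<close>, so that prepending a letter there means prepending the
  value \<open>g + 1\<close> and raising all larger values. After prepending at gap \<open>k\<close>, an old gap \<open>h\<close> is lost
  through a new occurrence of 1432, 2143 or 3214 in which the letter just prepended is the second letter;
  \<open>kills_below\<close> concerns \<open>h \<le> k\<close> and \<open>kills_above\<close> concerns \<open>h \<ge> k\<close>.
\<close>

definition blocks :: "nat \<Rightarrow> nat \<Rightarrow> nat \<Rightarrow> nat \<Rightarrow> bool" where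
  "blocks g a b c \<longleftrightarrow> g < c \<and> c < b \<and> b < a \<or> a \<le> g \<and> g < c \<and> c < b \<or> b < a \<and> a \<le> g \<and> g < c"

definition gaps :: "nat list \<Rightarrow> nat set" where
  "gaps \<pi> = {g. g \<le> length \<pi> \<and> \<not> (\<exists>a b c. subseq [a, b, c] \<pi> \<and> blocks g a b c)}"

definition kills_below :: "nat list \<Rightarrow> nat \<Rightarrow> nat \<Rightarrow> bool" where
  "kills_below \<pi> k h \<longleftrightarrow> (\<exists>b c. subseq [b, c] \<pi> \<and> h < c \<and> c < b \<and> b \<le> k)"

definition kills_above :: "nat list \<Rightarrow> nat \<Rightarrow> nat \<Rightarrow> bool" where
  "kills_above \<pi> k h \<longleftrightarrow> k \<le> h \<and> (\<exists>b c. subseq [b, c] \<pi> \<and> h < c \<and> (c < b \<or> b \<le> k))"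

definition shift :: "nat \<Rightarrow> nat \<Rightarrow> nat" where
  "shift g x = (if x \<le> g then x else Suc x)"

definition insert_front :: "nat \<Rightarrow> nat list \<Rightarrow> nat list" where
  "insert_front g \<pi> = Suc g # map (shift g) \<pi>"

definition unshift :: "nat \<Rightarrow> nat \<Rightarrow> nat" where
  "unshift g h = (if h \<le> g then h else h - 1)"

text \<open>
  The data \<open>(gaps, kills_below, kills_above)\<close> evolve on their own: gap \<open>g\<close> splits into the two gaps
  \<open>g\<close> and \<open>g + 1\<close>, and \<open>unshift g\<close> maps new gaps to old ones.
\<close>

definition next_gaps :: "nat \<Rightarrow> nat set \<Rightarrow> (nat \<Rightarrow> nat \<Rightarrow> bool) \<Rightarrow> (nat \<Rightarrow> nat \<Rightarrow> bool) \<Rightarrow> nat set" where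
  "next_gaps g G K H = {h. unshift g h \<in> G \<and> \<not> (h \<le> g \<and> K g h) \<and> \<not> (g < h \<and> H g (h - 1))}"

definition next_kills_below :: "nat \<Rightarrow> (nat \<Rightarrow> nat \<Rightarrow> bool) \<Rightarrow> nat \<Rightarrow> nat \<Rightarrow> bool" where
  "next_kills_below g K k h \<longleftrightarrow> K (unshift g k) (unshift g h) \<or> h < g \<and> g < k"

definition next_kills_above :: "nat \<Rightarrow> nat \<Rightarrow> (nat \<Rightarrow> nat \<Rightarrow> bool) \<Rightarrow> nat \<Rightarrow> nat \<Rightarrow> bool" where
  "next_kills_above t g H k h \<longleftrightarrow>
     k \<le> h \<and> (H (unshift g k) (unshift g h) \<or> h < g \<or> g < k \<and> h < Suc t)"

section \<open>Occurrences in a permutation with a prepended letter\<close>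

lemma subseq_map_iff: "subseq xs (map f ys) \<longleftrightarrow> (\<exists>zs. subseq zs ys \<and> xs = map f zs)"
proof
  show "\<exists>zs. subseq zs ys \<and> xs = map f zs" if "subseq xs (map f ys)"
    using that
  proof (induction xs "map f ys" arbitrary: ys rule: list_emb.induct)
    case (list_emb_Cons xs ys' y)
    then obtain z zs where *: "ys = z # zs" "ys' = map f zs" by auto
    with list_emb_Cons obtain zs' where "subseq zs' zs" "xs = map f zs'" by auto
    then show ?case using * by (intro exI[of _ zs']) auto
  next
    case (list_emb_Cons2 x y xs ys')
    then obtain z zs where *: "ys = z # zs" "y = f z" "ys' = map f zs" by auto
    with list_emb_Cons2 obtain zs' where "subseq zs' zs" "xs = map f zs'" by auto
    then show ?case using * list_emb_Cons2.hyps by (intro exI[of _ "z # zs'"]) auto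
  qed auto
qed (auto intro: subseq_map)

lemma subseq_Cons_Cons_iff:
  "subseq (x # xs) (y # ys) \<longleftrightarrow> x = y \<and> subseq xs ys \<or> subseq (x # xs) ys"
  using subseq_Cons'[of x xs ys] by (cases "x = y") auto

lemma shift_less_iff [simp]: "shift g x < shift g y \<longleftrightarrow> x < y"
  and shift_le_iff [simp]: "shift g x \<le> h \<longleftrightarrow> x \<le> unshift g h"
  and less_shift_iff [simp]: "h < shift g x \<longleftrightarrow> unshift g h < x"
  by (auto simp: shift_def unshift_def)

lemma shift_eq_iff [simp]: "shift g x = shift g y \<longleftrightarrow> x = y"
  by (auto simp: shift_def)

lemma inj_shift: "inj (shift g)"
  by (auto intro: injI)

lemma subseq_insert_front:
  "subseq (x # xs) (insert_front g \<pi>) \<longleftrightarrow>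
     (\<exists>zs. subseq zs \<pi> \<and> x = Suc g \<and> xs = map (shift g) zs) \<or>
     (\<exists>z zs. subseq (z # zs) \<pi> \<and> x = shift g z \<and> xs = map (shift g) zs)"
  unfolding insert_front_def subseq_Cons_Cons_iff subseq_map_iff by (auto simp: Cons_eq_map_conv)

lemma Cons_eq_map: "x # xs = map f zs \<longleftrightarrow> (\<exists>z zs'. zs = z # zs' \<and> x = f z \<and> xs = map f zs')"
  by (cases zs) auto

lemma subseq2_insert_front:
  "(\<exists>b c. subseq [b, c] (insert_front g \<pi>) \<and> Q b c) \<longleftrightarrow>
     (\<exists>c\<in>set \<pi>. Q (Suc g) (shift g c)) \<or> (\<exists>b c. subseq [b, c] \<pi> \<and> Q (shift g b) (shift g c))"
proof -
  have "subseq [b, c] (insert_front g \<pi>) \<longleftrightarrow> b = Suc g \<and> (\<exists>c'. subseq [c'] \<pi> \<and> c = shift g c') \<or>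
      (\<exists>b' c'. subseq [b', c'] \<pi> \<and> b = shift g b' \<and> c = shift g c')" for b c
    unfolding subseq_insert_front by (simp add: Cons_eq_map) blast
  then show ?thesis unfolding subseq_singleton_left by (simp only:) (rule iffI; elim exE conjE disjE bexE; hypsubst?; blast)
qed

lemma subseq3_insert_front:
  "(\<exists>a b c. subseq [a, b, c] (insert_front g \<pi>) \<and> Q a b c) \<longleftrightarrow>
     (\<exists>b c. subseq [b, c] \<pi> \<and> Q (Suc g) (shift g b) (shift g c)) \<or>
     (\<exists>a b c. subseq [a, b, c] \<pi> \<and> Q (shift g a) (shift g b) (shift g c))"
proof -
  have "subseq [a, b, c] (insert_front g \<pi>) \<longleftrightarrow>
      a = Suc g \<and> (\<exists>b' c'. subseq [b', c'] \<pi> \<and> b = shift g b' \<and> c = shift g c') \<or>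
      (\<exists>a' b' c'. subseq [a', b', c'] \<pi> \<and> a = shift g a' \<and> b = shift g b' \<and> c = shift g c')" for a b c
    unfolding subseq_insert_front by (simp add: Cons_eq_map) blast
  then show ?thesis by (simp only:) (rule iffI; elim exE conjE disjE; hypsubst?; blast)
qed

lemma subseq4_insert_front:
  "(\<exists>a b c d. subseq [a, b, c, d] (insert_front g \<pi>) \<and> Q a b c d) \<longleftrightarrow>
     (\<exists>b c d. subseq [b, c, d] \<pi> \<and> Q (Suc g) (shift g b) (shift g c) (shift g d)) \<or>
     (\<exists>a b c d. subseq [a, b, c, d] \<pi> \<and> Q (shift g a) (shift g b) (shift g c) (shift g d))"
    (is "?l \<longleftrightarrow> ?r")
proof -
  have *: "subseq [a, b, c, d] (insert_front g \<pi>) \<longleftrightarrow>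
      a = Suc g \<and> (\<exists>b' c' d'. subseq [b', c', d'] \<pi> \<and> b = shift g b' \<and> c = shift g c' \<and> d = shift g d') \<or>
      (\<exists>a' b' c' d'. subseq [a', b', c', d'] \<pi> \<and>
         a = shift g a' \<and> b = shift g b' \<and> c = shift g c' \<and> d = shift g d')" for a b c d
    unfolding subseq_insert_front by (simp add: Cons_eq_map) blast
  show ?thesis
  proof
    assume ?l
    then obtain a b c d where 1: "subseq [a, b, c, d] (insert_front g \<pi>)" and 2: "Q a b c d" by blast
    from 1[unfolded *] show ?r
    proof (elim disjE conjE exE)
      fix b' c' d'
      assume "a = Suc g" "b = shift g b'" "c = shift g c'" "d = shift g d'" and 3: "subseq [b', c', d'] \<pi>"
      with 2 have "Q (Suc g) (shift g b') (shift g c') (shift g d')" by simp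
      with 3 show ?r by blast
    next
      fix a' b' c' d'
      assume "a = shift g a'" "b = shift g b'" "c = shift g c'" "d = shift g d'"
        and 3: "subseq [a', b', c', d'] \<pi>"
      with 2 have "Q (shift g a') (shift g b') (shift g c') (shift g d')" by simp
      with 3 show ?r by blast
    qed
  next
    have "subseq [Suc g, shift g b, shift g c, shift g d] (insert_front g \<pi>)"
      if "subseq [b, c, d] \<pi>" for b c d
      using that unfolding * by blast
    moreover have "subseq [shift g a, shift g b, shift g c, shift g d] (insert_front g \<pi>)"
      if "subseq [a, b, c, d] \<pi>" for a b c d
      using that unfolding * by blast
    moreover assume ?r
    ultimately show ?l by (elim disjE exE conjE) blast+
  qed
qed

lemma Suc_less_shift_iff [simp]: "Suc g < shift g x \<longleftrightarrow> g < x"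
  and shift_less_Suc_iff [simp]: "shift g x < Suc g \<longleftrightarrow> x \<le> g"
  by (auto simp: shift_def)

text \<open>An occurrence either lies in the raised copy of \<open>\<pi>\<close>, where
  \<open>shift g\<close> preserves order, or starts with the new letter, and then its other three
  letters block \<open>g\<close>.\<close>

lemma good_insert_front:
  assumes "g \<le> length \<pi>"
  shows "good (insert_front g \<pi>) \<longleftrightarrow> good \<pi> \<and> g \<in> gaps \<pi>"
proof -
  have 1: "bad (shift g a) (shift g b) (shift g c) (shift g d) \<longleftrightarrow> bad a b c d" for a b c d
    by (simp only: bad_def shift_less_iff)
  have 2: "bad (Suc g) (shift g b) (shift g c) (shift g d) \<longleftrightarrow> blocks g b c d" for b c d
    by (simp only: bad_def blocks_def shift_less_iff Suc_less_shift_iff shift_less_Suc_iff)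
  show ?thesis
    unfolding good_def subseq4_insert_front gaps_def using assms by (auto simp: 1 2)
qed

lemma gaps_insert_front:
  assumes "g \<le> length \<pi>"
  shows "gaps (insert_front g \<pi>) = next_gaps g (gaps \<pi>) (kills_below \<pi>) (kills_above \<pi>)"
proof -
  have 1: "blocks h (shift g a) (shift g b) (shift g c) \<longleftrightarrow> blocks (unshift g h) a b c" for h a b c
    unfolding blocks_def shift_less_iff shift_le_iff by (auto simp: shift_def unshift_def)
  \<comment> \<open>With the new letter in second place, 1432 requires \<open>h\<close> below it,
    while 2143 and 3214 require \<open>h\<close> above it; in the latter case \<open>h - 1\<close>
    is the old gap.\<close>
  have 2: "blocks h (Suc g) (shift g b) (shift g c) \<longleftrightarrow>
      h \<le> g \<and> h < c \<and> c < b \<and> b \<le> g \<or> g < h \<and> h - 1 < c \<and> (c < b \<or> b \<le> g)" for h b c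
    by (auto simp: blocks_def shift_def)
  have 3: "h \<le> length (insert_front g \<pi>) \<longleftrightarrow> unshift g h \<le> length \<pi>" for h
    using assms by (auto simp: insert_front_def unshift_def)
  have "h \<in> gaps (insert_front g \<pi>) \<longleftrightarrow> h \<in> next_gaps g (gaps \<pi>) (kills_below \<pi>) (kills_above \<pi>)" for h
    unfolding gaps_def next_gaps_def mem_Collect_eq subseq3_insert_front 1 2 3 kills_below_def kills_above_def
    using le_diff_conv2[of 1 h g] by (cases "h \<le> g") (simp_all add: conj_ac)
  then show ?thesis by blast
qed

lemma kills_below_insert_front:
  assumes "set \<pi> = {1..n}" "g \<le> n"
  shows "kills_below (insert_front g \<pi>) = next_kills_below g (kills_below \<pi>)"
proof (intro ext)
  fix k h
  have "(\<exists>c\<in>set \<pi>. h < shift g c \<and> shift g c < Suc g \<and> Suc g \<le> k) \<longleftrightarrow> h < g \<and> g < k"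
  proof
    assume "h < g \<and> g < k"
    \<comment> \<open>\<open>g\<close> is the largest letter that is not raised, hence the best
      choice for \<open>c\<close>.\<close>
    then have "g \<in> set \<pi>" "h < shift g g \<and> shift g g < Suc g \<and> Suc g \<le> k"
      using assms by (simp_all add: shift_def)
    then show "\<exists>c\<in>set \<pi>. h < shift g c \<and> shift g c < Suc g \<and> Suc g \<le> k" by blast
  qed (auto simp: shift_def split: if_splits)
  then show "kills_below (insert_front g \<pi>) k h = next_kills_below g (kills_below \<pi>) k h"
    unfolding kills_below_def next_kills_below_def subseq2_insert_front shift_less_iff
    unfolding shift_le_iff less_shift_iff by blast
qed

lemma kills_above_insert_front:
  assumes "set \<pi> = {1..n}" "g \<le> n"
  shows "kills_above (insert_front g \<pi>) = next_kills_above n g (kills_above \<pi>)"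
proof (intro ext)
  fix k h
  have *: "(\<exists>c\<in>set \<pi>. h < shift g c \<and> (shift g c < Suc g \<or> Suc g \<le> k)) \<longleftrightarrow> h < g \<or> g < k \<and> h < Suc n"
    (is "?l \<longleftrightarrow> ?r") if "k \<le> h"
  proof
    assume ?l
    then show ?r using assms by (auto simp: shift_def split: if_splits)
  next
    assume ?r
    then consider "h < g" | "g < k" "h < Suc n" by blast
    then show ?l
    proof cases
      case 1
      then have "g \<in> set \<pi>" "h < shift g g \<and> shift g g < Suc g" using assms by (simp_all add: shift_def)
      then show ?l by blast
    next
      case 2
      \<comment> \<open>Here any letter above \<open>h\<close> serves as \<open>c\<close>, so the
        largest one decides; it is raised to \<open>Suc n\<close> because
        \<open>g < k \<le> h \<le> n\<close>.\<close>
      then have "n \<in> set \<pi>" "h < shift g n \<and> Suc g \<le> k" using assms that by (simp_all add: shift_def)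
      then show ?l by blast
    qed
  qed
  have "unshift g k \<le> unshift g h" if "k \<le> h" using that by (auto simp: unshift_def)
  with * show "kills_above (insert_front g \<pi>) k h = next_kills_above n g (kills_above \<pi>) k h"
    unfolding kills_above_def next_kills_above_def subseq2_insert_front shift_less_iff
    unfolding shift_le_iff less_shift_iff by (cases "k \<le> h") (simp_all add: disj_ac)
qed

section \<open>Succession rules\<close>

fun extensions :: "nat \<Rightarrow> nat \<Rightarrow> nat set \<Rightarrow> (nat \<Rightarrow> nat \<Rightarrow> bool) \<Rightarrow> (nat \<Rightarrow> nat \<Rightarrow> bool) \<Rightarrow> nat" where
  "extensions 0 t G K H = 1"
| "extensions (Suc n) t G K H =
     (\<Sum>g\<in>G. extensions n (Suc t) (next_gaps g G K H) (next_kills_below g K) (next_kills_above t g H))"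

text \<open>
  The label of a state determines the tree of all its extensions; \<open>count n f\<close> counts
  the descendants at depth \<open>n\<close>. Each equation below lists the labels of the children.
\<close>

datatype family = W nat nat | X nat nat | Z nat nat | P nat | R nat | Y nat

fun count :: "nat \<Rightarrow> family \<Rightarrow> nat" where
  "count 0 f = 1"
| "count (Suc n) (W a b) = (\<Sum>i=1..a. count n (X i b)) + count n (W a (Suc b))
     + (\<Sum>j=1..b. count n (P j)) + count n (W (Suc b) 0)"
| "count (Suc n) (X a b) = (\<Sum>i=1..a-1. count n (Z i b)) + count n (X a b) + count n (P 1)
     + (\<Sum>j=2..Suc b. count n (Y j)) + count n (W (Suc b) 0)"
| "count (Suc n) (Z a b) = (\<Sum>i=1..a. count n (Z i b))
     + (\<Sum>j=1..Suc b. count n (Y j)) + count n (W (Suc b) 0)"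
| "count (Suc n) (P j) = count n (P 1) + (\<Sum>i=2..j. count n (R i)) + count n (P j)
     + count n (W 1 0)"
| "count (Suc n) (R c) = (\<Sum>i=1..c. count n (R i)) + count n (W 0 0)"
| "count (Suc n) (Y c) = (\<Sum>i=1..c-1. count n (R i)) + count n (Y c) + count n (W 1 0)"

text \<open>Each rank from 1 to \<open>card L\<close> is taken exactly once. This turns sums over
  gaps into sums over labels, which know only how many gaps there are. Adding a new maximum leaves
  the earlier ranks alone.\<close>

lemma sum_rank:
  fixes L :: "nat set" and F :: "nat \<Rightarrow> nat"
  assumes "finite L"
  shows "(\<Sum>g\<in>L. F (card {h\<in>L. h \<le> g})) = (\<Sum>i=1..card L. F i)"
  using assms
proof (induction rule: finite_linorder_max_induct)
  case (insert b A)
  have "{h \<in> insert b A. h \<le> g} = {h\<in>A. h \<le> g}" if "g \<in> A" for g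
    using insert.hyps that by auto
  moreover have "{h \<in> insert b A. h \<le> b} = insert b A"
    using insert.hyps by auto
  moreover have "b \<notin> A" using insert.hyps by auto
  ultimately show ?case using insert by (simp cong: sum.cong)
qed simp

text \<open>
  Prepending at gap \<open>k\<close> kills the gaps \<open>h \<le> k\<close> below \<open>\<alpha> k\<close> and the gaps \<open>h \<ge> k\<close> below \<open>\<beta> k\<close>;
  in the case \<open>h = k\<close> of the latter it is the upper half of the split gap that dies.
\<close>

definition thresholds where
  "thresholds t G K H \<alpha> \<beta> \<longleftrightarrow>
     (\<forall>k\<in>G. \<forall>h\<in>G. h \<le> k \<longrightarrow> (K k h \<longleftrightarrow> h < \<alpha> k)) \<and>
     (\<forall>k\<in>G. \<forall>h\<in>G. k \<le> h \<longrightarrow> (H k h \<longleftrightarrow> h < (\<beta> k :: nat)))"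

text \<open>The surviving lower gaps keep their names and the upper ones move up by one. The gap
  \<open>g\<close> can lie in both parts, which accounts for its two halves.\<close>

lemma next_gaps_thresholds:
  assumes "thresholds t G K H \<alpha> \<beta>" "g \<in> G"
  shows "next_gaps g G K H = {h\<in>G. \<alpha> g \<le> h \<and> h \<le> g} \<union> Suc ` {h\<in>G. g \<le> h \<and> \<beta> g \<le> h}"
proof -
  have "h \<in> next_gaps g G K H \<longleftrightarrow>
      h \<in> {h\<in>G. \<alpha> g \<le> h \<and> h \<le> g} \<union> Suc ` {h\<in>G. g \<le> h \<and> \<beta> g \<le> h}" for h
  proof (cases "h \<le> g")
    case True
    then show ?thesis using assms by (auto simp: next_gaps_def unshift_def thresholds_def)
  next
    case False
    then obtain h' where "h = Suc h'" "g \<le> h'" by (cases h) auto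
    then show ?thesis using assms
      by (auto simp: next_gaps_def unshift_def thresholds_def)
  qed
  then show ?thesis by blast
qed

text \<open>Every new gap is an element of \<open>lo\<close> or the successor of one of
  \<open>hi\<close>, so new thresholds need checking only on the pairs lo-lo, lo-hi and hi-hi. The
  extra disjuncts \<open>h < g\<close> and \<open>h < t\<close> are the kills due to pairs that
  begin with the new letter. All lemmas on children below are instances.\<close>

lemma thresholds_next:
  assumes G: "thresholds t G K H \<alpha> \<beta>" "g \<in> G"
    and G': "G' = next_gaps g G K H"
    and lo: "{h\<in>G. \<alpha> g \<le> h \<and> h \<le> g} = lo" and hi: "{h\<in>G. g \<le> h \<and> \<beta> g \<le> h} = hi"
    and a1: "\<And>k h. \<lbrakk>k \<in> lo; h \<in> lo; h \<le> k\<rbrakk> \<Longrightarrow> h < \<alpha> k \<longleftrightarrow> h < \<alpha>' k"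
    and a2: "\<And>k h. \<lbrakk>k \<in> hi; h \<in> lo\<rbrakk> \<Longrightarrow> h < \<alpha> k \<or> h < g \<longleftrightarrow> h < \<alpha>' (Suc k)"
    and a3: "\<And>k h. \<lbrakk>k \<in> hi; h \<in> hi; h \<le> k\<rbrakk> \<Longrightarrow> h < \<alpha> k \<longleftrightarrow> Suc h < \<alpha>' (Suc k)"
    and b1: "\<And>k h. \<lbrakk>k \<in> lo; h \<in> lo; k \<le> h\<rbrakk> \<Longrightarrow> h < \<beta> k \<or> h < g \<longleftrightarrow> h < \<beta>' k"
    and b2: "\<And>k h. \<lbrakk>k \<in> lo; h \<in> hi\<rbrakk> \<Longrightarrow> h < \<beta> k \<longleftrightarrow> Suc h < \<beta>' k"
    and b3: "\<And>k h. \<lbrakk>k \<in> hi; h \<in> hi; k \<le> h\<rbrakk> \<Longrightarrow> h < \<beta> k \<or> h < t \<longleftrightarrow> Suc h < \<beta>' (Suc k)"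
  shows "G' = lo \<union> Suc ` hi \<and> thresholds (Suc t) G' (next_kills_below g K) (next_kills_above t g H) \<alpha>' \<beta>'"
proof -
  have eq: "G' = lo \<union> Suc ` hi"
    using next_gaps_thresholds[OF G] lo hi G' by simp
  have K: "K k h \<longleftrightarrow> h < \<alpha> k" if "k \<in> G" "h \<in> G" "h \<le> k" for k h
    using G that by (auto simp: thresholds_def)
  have H: "H k h \<longleftrightarrow> h < \<beta> k" if "k \<in> G" "h \<in> G" "k \<le> h" for k h
    using G that by (auto simp: thresholds_def)
  have loD: "h \<in> G \<and> h \<le> g" if "h \<in> lo" for h using lo that by auto
  have hiD: "h \<in> G \<and> g \<le> h" if "h \<in> hi" for h using hi that by auto
  have "next_kills_below g K k h \<longleftrightarrow> h < \<alpha>' k" if kh: "k \<in> G'" "h \<in> G'" "h \<le> k" for k h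
  proof -
    consider "k \<in> lo" "h \<in> lo" | k0 where "k = Suc k0" "k0 \<in> hi" "h \<in> lo"
      | k0 h0 where "k = Suc k0" "k0 \<in> hi" "h = Suc h0" "h0 \<in> hi"
      | h0 where "k \<in> lo" "h = Suc h0" "h0 \<in> hi"
      using kh eq by auto
    then show ?thesis
    proof cases
      case 1
      then show ?thesis
        using loD[of k] loD[of h] K[of k h] a1 kh by (auto simp: next_kills_below_def unshift_def)
    next
      case 2
      then show ?thesis
        using hiD[of k0] loD[of h] K[of k0 h] a2[of k0 h] kh by (auto simp: next_kills_below_def unshift_def)
    next
      case 3
      then show ?thesis
        using hiD[of k0] hiD[of h0] K[of k0 h0] a3[of k0 h0] kh by (auto simp: next_kills_below_def unshift_def)
    next
      case 4
      then show ?thesis using loD[of k] hiD[of h0] kh by auto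
    qed
  qed
  moreover have "next_kills_above t g H k h \<longleftrightarrow> h < \<beta>' k" if kh: "k \<in> G'" "h \<in> G'" "k \<le> h" for k h
  proof -
    consider "k \<in> lo" "h \<in> lo" | h0 where "k \<in> lo" "h = Suc h0" "h0 \<in> hi"
      | k0 h0 where "k = Suc k0" "k0 \<in> hi" "h = Suc h0" "h0 \<in> hi"
      | k0 where "k = Suc k0" "k0 \<in> hi" "h \<in> lo"
      using kh eq by auto
    then show ?thesis
    proof cases
      case 1
      then show ?thesis
        using loD[of k] loD[of h] H[of k h] b1[of k h] kh by (auto simp: next_kills_above_def unshift_def)
    next
      case 2
      then show ?thesis
        using hiD[of h0] loD[of k] H[of k h0] b2[of k h0] kh by (auto simp: next_kills_above_def unshift_def)
    next
      case 3
      then show ?thesis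
        using hiD[of k0] hiD[of h0] H[of k0 h0] b3[of k0 h0] kh by (auto simp: next_kills_above_def unshift_def)
    next
      case 4
      then show ?thesis using loD[of h] hiD[of k0] kh by auto
    qed
  qed
  ultimately show ?thesis using eq by (simp add: thresholds_def)
qed

section \<open>The six shapes as arrangements of gaps and thresholds\<close>

definition layout :: "nat set \<Rightarrow> nat \<Rightarrow> nat set \<Rightarrow> nat \<Rightarrow> nat set \<Rightarrow> bool" where
  "layout L m V t G \<longleftrightarrow> finite L \<and> finite V \<and> (\<forall>x\<in>L. x < m) \<and> (\<forall>x\<in>V. m < x \<and> x < t) \<and> m < t \<and>
     G = L \<union> {m} \<union> V \<union> {t}"

text \<open>A threshold 0 kills nothing. An upper threshold \<open>t\<close> leaves only the top gap
  above the insertion, since \<open>t\<close> is the largest gap.\<close>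

abbreviation thresholds_W where
  "thresholds_W m t G K H \<equiv> thresholds t G K H
     (\<lambda>k. if k \<le> m then 0 else m) (\<lambda>k. if k < m then m else if k = m then 0 else t)"

abbreviation thresholds_X where
  "thresholds_X l m t G K H \<equiv> thresholds t G K H
     (\<lambda>k. if k < m then 0 else if k = m then l else m) (\<lambda>k. if k < m then m else t)"

abbreviation thresholds_P where
  "thresholds_P m l t G K H \<equiv> thresholds t G K H
     (\<lambda>k. if k = t then l else 0) (\<lambda>k. if k = m then l else t)"

abbreviation thresholds_R where
  "thresholds_R l t G K H \<equiv> thresholds t G K H (\<lambda>k. if k = t then l else 0) (\<lambda>k. t)"

text \<open>\<open>Z\<close> is \<open>X\<close> with the threshold \<open>l\<close> raised to
  \<open>m\<close>: inserting at \<open>m\<close> spares the gap \<open>l\<close> in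
  \<open>X\<close> but kills all of \<open>L\<close> in \<open>Z\<close>. In the same way
  \<open>R\<close> is \<open>Y\<close> with \<open>l\<close> raised to \<open>t\<close>. In
  \<open>P\<close> the gap \<open>m\<close> is the lowest one and \<open>l\<close> the highest below
  \<open>t\<close>.\<close>

fun fits :: "family \<Rightarrow> nat \<Rightarrow> nat set \<Rightarrow> (nat \<Rightarrow> nat \<Rightarrow> bool) \<Rightarrow> (nat \<Rightarrow> nat \<Rightarrow> bool) \<Rightarrow> bool" where
  "fits (W a b) t G K H \<longleftrightarrow> (\<exists>L m V. layout L m V t G \<and> card L = a \<and> card V = b \<and>
     thresholds_W m t G K H)"
| "fits (X a b) t G K H \<longleftrightarrow> (\<exists>L l m V. layout L m V t G \<and> card L = a \<and> card V = b \<and>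
     l \<in> L \<and> (\<forall>x\<in>L. x \<le> l) \<and> thresholds_X l m t G K H)"
| "fits (Z a b) t G K H \<longleftrightarrow> (\<exists>L m V. layout L m V t G \<and> card L = a \<and> card V = b \<and>
     thresholds_X m m t G K H)"
| "fits (P j) t G K H \<longleftrightarrow> (\<exists>m U l. finite U \<and> (\<forall>x\<in>U. m < x \<and> x \<le> l) \<and> l \<in> U \<and> l < t \<and>
     card U = j \<and> G = {m} \<union> U \<union> {t} \<and> thresholds_P m l t G K H)"
| "fits (R c) t G K H \<longleftrightarrow> (\<exists>L. finite L \<and> (\<forall>x\<in>L. x < t) \<and> card L = c \<and>
     G = L \<union> {t} \<and> thresholds_R t t G K H)"
| "fits (Y c) t G K H \<longleftrightarrow> (\<exists>L l. finite L \<and> (\<forall>x\<in>L. x \<le> l) \<and> l \<in> L \<and> l < t \<and> card L = c \<and>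
     G = L \<union> {t} \<and> thresholds_R l t G K H)"

abbreviation next_fits where
  "next_fits f g t G K H \<equiv> fits f (Suc t) (next_gaps g G K H) (next_kills_below g K) (next_kills_above t g H)"

section \<open>Children of each shape\<close>

lemma W_insert_below:
  assumes l: "layout L m V t G" and th: "thresholds_W m t G K H" and g: "g \<in> L"
  shows "next_fits (X (card {h\<in>L. h \<le> g}) (card V)) g t G K H"
proof -
  have G: "finite L" "finite V" "\<forall>x\<in>L. x < m \<and> x < t" "\<forall>x\<in>V. m < x \<and> x < t" "m < t"
    "G = L \<union> {m} \<union> V \<union> {t}"
    using l by (auto simp: layout_def intro: less_trans)
  note Gord = G(3,4,5) and Gside = G(1-5)
  have gV: "\<forall>y\<in>V. g < y \<and> g \<le> y"
    using G g by (meson less_imp_le less_trans)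
  have gG: "g \<in> G" using g gV G by auto
  have lo: "{h\<in>G. (if g \<le> m then 0 else m) \<le> h \<and> h \<le> g} = {h\<in>L. h \<le> g}" using g gV G by auto
  have hi: "{h\<in>G. g \<le> h \<and> (if g < m then m else if g = m then 0 else t) \<le> h} = (insert m (insert t V))" using g gV G by auto
  \<comment> \<open>The new pairs make a later insertion at \<open>Suc m\<close> kill whatever lies
    below \<open>g\<close>, so \<open>g\<close>, now the largest gap under \<open>Suc m\<close>,
    becomes the parameter \<open>l\<close> of \<open>X\<close>.\<close>
  have *: "next_gaps g G K H = {h\<in>L. h \<le> g} \<union> Suc ` (insert m (insert t V)) \<and>
      thresholds_X g (Suc m) (Suc t) (next_gaps g G K H) (next_kills_below g K) (next_kills_above t g H)"
    by (rule thresholds_next[OF th gG refl lo hi]) (use g gV Gord in auto)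
  have lay: "layout {h\<in>L. h \<le> g} (Suc m) (Suc ` V) (Suc t) (next_gaps g G K H)"
    unfolding conjunct1[OF *] using g gV G by (auto simp: layout_def)
  show ?thesis
    unfolding fits.simps
    by (rule exI[of _ "{h\<in>L. h \<le> g}"], rule exI[of _ "g"], rule exI[of _ "Suc m"], rule exI[of _ "Suc ` V"])
      (use lay conjunct1[OF *] conjunct2[OF *] g gV Gside in \<open>auto simp: card_insert_if card_image\<close>)
qed

text \<open>Nothing dies: the lower half of \<open>m\<close> keeps its role and the upper half joins
  \<open>V\<close>.\<close>

lemma W_insert_mid:
  assumes l: "layout L m V t G" and th: "thresholds_W m t G K H"
  shows "next_fits (W (card L) (Suc (card V))) m t G K H"
proof -
  have G: "finite L" "finite V" "\<forall>x\<in>L. x < m \<and> x < t" "\<forall>x\<in>V. m < x \<and> x < t" "m < t"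
    "G = L \<union> {m} \<union> V \<union> {t}"
    using l by (auto simp: layout_def intro: less_trans)
  note Gord = G(3,4,5) and Gside = G(1-5)
  have gG: "m \<in> G" using G by auto
  have lo: "{h\<in>G. (if m \<le> m then 0 else m) \<le> h \<and> h \<le> m} = (insert m L)" using G by auto
  have hi: "{h\<in>G. m \<le> h \<and> (if m < m then m else if m = m then 0 else t) \<le> h} = (insert m (insert t V))" using G by auto
  have *: "next_gaps m G K H = (insert m L) \<union> Suc ` (insert m (insert t V)) \<and>
      thresholds_W m (Suc t) (next_gaps m G K H) (next_kills_below m K) (next_kills_above t m H)"
    by (rule thresholds_next[OF th gG refl lo hi]) (use  Gord in auto)
  have lay: "layout L m (Suc ` insert m V) (Suc t) (next_gaps m G K H)"
    unfolding conjunct1[OF *] using G by (auto simp: layout_def)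
  show ?thesis
    unfolding fits.simps
    by (rule exI[of _ "L"], rule exI[of _ "m"], rule exI[of _ "Suc ` insert m V"])
      (use lay conjunct1[OF *] conjunct2[OF *]  Gside in \<open>auto simp: card_insert_if card_image\<close>)
qed

lemma W_insert_above:
  assumes l: "layout L m V t G" and th: "thresholds_W m t G K H" and g: "g \<in> V"
  shows "next_fits (P (card {h\<in>V. h \<le> g})) g t G K H"
proof -
  have G: "finite L" "finite V" "\<forall>x\<in>L. x < m \<and> x < t" "\<forall>x\<in>V. m < x \<and> x < t" "m < t"
    "G = L \<union> {m} \<union> V \<union> {t}"
    using l by (auto simp: layout_def intro: less_trans)
  note Gord = G(3,4,5) and Gside = G(1-5)
  have gG: "g \<in> G" using g G by auto
  have lo: "{h\<in>G. (if g \<le> m then 0 else m) \<le> h \<and> h \<le> g} = (insert m {h\<in>V. h \<le> g})" using g G by auto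
  have hi: "{h\<in>G. g \<le> h \<and> (if g < m then m else if g = m then 0 else t) \<le> h} = {t}" using g G by auto
  have *: "next_gaps g G K H = (insert m {h\<in>V. h \<le> g}) \<union> Suc ` {t} \<and>
      thresholds_P m g (Suc t) (next_gaps g G K H) (next_kills_below g K) (next_kills_above t g H)"
    by (rule thresholds_next[OF th gG refl lo hi]) (use g Gord in auto)
  show ?thesis
    unfolding fits.simps
    by (rule exI[of _ "m"], rule exI[of _ "{h\<in>V. h \<le> g}"], rule exI[of _ "g"])
      (use conjunct1[OF *] conjunct2[OF *] g Gside in \<open>auto simp: card_insert_if card_image\<close>)
qed

text \<open>All of \<open>L\<close> dies. The gaps \<open>m\<close> and \<open>V\<close> become the
  new lower part, and the old top gap takes the role of \<open>m\<close>.\<close>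

lemma W_insert_top:
  assumes l: "layout L m V t G" and th: "thresholds_W m t G K H"
  shows "next_fits (W (Suc (card V)) 0) t t G K H"
proof -
  have G: "finite L" "finite V" "\<forall>x\<in>L. x < m \<and> x < t" "\<forall>x\<in>V. m < x \<and> x < t" "m < t"
    "G = L \<union> {m} \<union> V \<union> {t}"
    using l by (auto simp: layout_def intro: less_trans)
  note Gord = G(3,4,5) and Gside = G(1-5)
  have gG: "t \<in> G" using  G by auto
  have lo: "{h\<in>G. (if t \<le> m then 0 else m) \<le> h \<and> h \<le> t} = (insert m (insert t V))" using  G by auto
  have hi: "{h\<in>G. t \<le> h \<and> (if t < m then m else if t = m then 0 else t) \<le> h} = {t}" using  G by auto
  have *: "next_gaps t G K H = (insert m (insert t V)) \<union> Suc ` {t} \<and>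
      thresholds_W t (Suc t) (next_gaps t G K H) (next_kills_below t K) (next_kills_above t t H)"
    by (rule thresholds_next[OF th gG refl lo hi]) (use  Gord in auto)
  have lay: "layout (insert m V) t {} (Suc t) (next_gaps t G K H)"
    unfolding conjunct1[OF *] using  G by (auto simp: layout_def)
  show ?thesis
    unfolding fits.simps
    by (rule exI[of _ "insert m V"], rule exI[of _ "t"], rule exI[of _ "{}"])
      (use lay conjunct1[OF *] conjunct2[OF *]  Gside in \<open>auto simp: card_insert_if card_image\<close>)
qed

text \<open>The parameter \<open>c\<close> covers both \<open>X\<close> (with \<open>c = l\<close>)
  and \<open>Z\<close> (with \<open>c = m\<close>). Since the surviving lower gaps are at most
  \<open>g < c\<close>, the next insertion at the middle gap kills all of them, which is the shape
  \<open>Z\<close>.\<close>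

lemma X_insert_below:
  assumes l: "layout L m V t G" and th: "thresholds_X c m t G K H" and g: "g \<in> L" "g < c" and cm: "c \<le> m"
  shows "next_fits (Z (card {h\<in>L. h \<le> g}) (card V)) g t G K H"
proof -
  have G: "finite L" "finite V" "\<forall>x\<in>L. x < m \<and> x < t" "\<forall>x\<in>V. m < x \<and> x < t" "m < t"
    "G = L \<union> {m} \<union> V \<union> {t}"
    using l by (auto simp: layout_def intro: less_trans)
  note Gord = G(3,4,5) and Gside = G(1-5)
  have gV: "\<forall>y\<in>V. g < y \<and> g \<le> y"
    using G g(1) by (meson less_imp_le less_trans)
  have gG: "g \<in> G" using cm g gV G by auto
  have lo: "{h\<in>G. (if g < m then 0 else if g = m then c else m) \<le> h \<and> h \<le> g} = {h\<in>L. h \<le> g}" using cm g gV G by auto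
  have hi: "{h\<in>G. g \<le> h \<and> (if g < m then m else t) \<le> h} = (insert m (insert t V))" using cm g gV G by auto
  have *: "next_gaps g G K H = {h\<in>L. h \<le> g} \<union> Suc ` (insert m (insert t V)) \<and>
      thresholds_X (Suc m) (Suc m) (Suc t) (next_gaps g G K H) (next_kills_below g K) (next_kills_above t g H)"
    by (rule thresholds_next[OF th gG refl lo hi]) (use cm g gV Gord in auto)
  have lay: "layout {h\<in>L. h \<le> g} (Suc m) (Suc ` V) (Suc t) (next_gaps g G K H)"
    unfolding conjunct1[OF *] using cm g gV G by (auto simp: layout_def)
  show ?thesis
    unfolding fits.simps
    by (rule exI[of _ "{h\<in>L. h \<le> g}"], rule exI[of _ "Suc m"], rule exI[of _ "Suc ` V"])
      (use lay conjunct1[OF *] conjunct2[OF *] cm g gV Gside in \<open>auto simp: card_insert_if card_image\<close>)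
qed

lemma X_insert_below_max:
  assumes l: "layout L m V t G" and th: "thresholds_X c m t G K H" and c: "c \<in> L" "\<forall>x\<in>L. x \<le> c"
  shows "next_fits (X (card L) (card V)) c t G K H"
proof -
  have G: "finite L" "finite V" "\<forall>x\<in>L. x < m \<and> x < t" "\<forall>x\<in>V. m < x \<and> x < t" "m < t"
    "G = L \<union> {m} \<union> V \<union> {t}"
    using l by (auto simp: layout_def intro: less_trans)
  note Gord = G(3,4,5) and Gside = G(1-5)
  have gV: "\<forall>y\<in>V. c < y \<and> c \<le> y"
    using G c(1) by (meson less_imp_le less_trans)
  have gG: "c \<in> G" using c gV G by auto
  have lo: "{h\<in>G. (if c < m then 0 else if c = m then c else m) \<le> h \<and> h \<le> c} = L" using c gV G by auto
  have hi: "{h\<in>G. c \<le> h \<and> (if c < m then m else t) \<le> h} = (insert m (insert t V))" using c gV G by auto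
  have *: "next_gaps c G K H = L \<union> Suc ` (insert m (insert t V)) \<and>
      thresholds_X c (Suc m) (Suc t) (next_gaps c G K H) (next_kills_below c K) (next_kills_above t c H)"
    by (rule thresholds_next[OF th gG refl lo hi]) (use c gV Gord in auto)
  have lay: "layout L (Suc m) (Suc ` V) (Suc t) (next_gaps c G K H)"
    unfolding conjunct1[OF *] using c gV G by (auto simp: layout_def)
  show ?thesis
    unfolding fits.simps
    by (rule exI[of _ "L"], rule exI[of _ "c"], rule exI[of _ "Suc m"], rule exI[of _ "Suc ` V"])
      (use lay conjunct1[OF *] conjunct2[OF *] c gV Gside in \<open>auto simp: card_insert_if card_image\<close>)
qed

text \<open>Below the insertion only \<open>c\<close> and \<open>m\<close> survive, so
  \<open>c\<close> becomes the lowest gap of a \<open>P\<close> whose set \<open>U\<close> is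
  \<open>{m}\<close>.\<close>

lemma X_insert_mid:
  assumes l: "layout L m V t G" and th: "thresholds_X c m t G K H" and c: "c \<in> L" "\<forall>x\<in>L. x \<le> c"
  shows "next_fits (P 1) m t G K H"
proof -
  have G: "finite L" "finite V" "\<forall>x\<in>L. x < m \<and> x < t" "\<forall>x\<in>V. m < x \<and> x < t" "m < t"
    "G = L \<union> {m} \<union> V \<union> {t}"
    using l by (auto simp: layout_def intro: less_trans)
  note Gord = G(3,4,5) and Gside = G(1-5)
  have gG: "m \<in> G" using c G by auto
  have lo: "{h\<in>G. (if m < m then 0 else if m = m then c else m) \<le> h \<and> h \<le> m} = {c, m}" using c G by auto
  have hi: "{h\<in>G. m \<le> h \<and> (if m < m then m else t) \<le> h} = {t}" using c G by auto
  have *: "next_gaps m G K H = {c, m} \<union> Suc ` {t} \<and>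
      thresholds_P c m (Suc t) (next_gaps m G K H) (next_kills_below m K) (next_kills_above t m H)"
    by (rule thresholds_next[OF th gG refl lo hi]) (use c Gord in auto)
  show ?thesis
    unfolding fits.simps
    by (rule exI[of _ "c"], rule exI[of _ "{m}"], rule exI[of _ "m"])
      (use conjunct1[OF *] conjunct2[OF *] c Gside in \<open>auto simp: card_insert_if card_image\<close>)
qed

lemma Z_insert_mid:
  assumes l: "layout L m V t G" and th: "thresholds_X m m t G K H"
  shows "next_fits (Y 1) m t G K H"
proof -
  have G: "finite L" "finite V" "\<forall>x\<in>L. x < m \<and> x < t" "\<forall>x\<in>V. m < x \<and> x < t" "m < t"
    "G = L \<union> {m} \<union> V \<union> {t}"
    using l by (auto simp: layout_def intro: less_trans)
  note Gord = G(3,4,5) and Gside = G(1-5)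
  have gG: "m \<in> G" using  G by auto
  have lo: "{h\<in>G. (if m < m then 0 else if m = m then m else m) \<le> h \<and> h \<le> m} = {m}" using  G by auto
  have hi: "{h\<in>G. m \<le> h \<and> (if m < m then m else t) \<le> h} = {t}" using  G by auto
  have *: "next_gaps m G K H = {m} \<union> Suc ` {t} \<and>
      thresholds_R m (Suc t) (next_gaps m G K H) (next_kills_below m K) (next_kills_above t m H)"
    by (rule thresholds_next[OF th gG refl lo hi]) (use  Gord in auto)
  show ?thesis
    unfolding fits.simps
    by (rule exI[of _ "{m}"], rule exI[of _ "m"])
      (use conjunct1[OF *] conjunct2[OF *]  Gside in \<open>auto simp: card_insert_if card_image\<close>)
qed

lemma X_insert_above:
  assumes l: "layout L m V t G" and th: "thresholds_X c m t G K H" and g: "g \<in> V" and cm: "c \<le> m"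
  shows "next_fits (Y (card {h\<in>insert m V. h \<le> g})) g t G K H"
proof -
  have G: "finite L" "finite V" "\<forall>x\<in>L. x < m \<and> x < t" "\<forall>x\<in>V. m < x \<and> x < t" "m < t"
    "G = L \<union> {m} \<union> V \<union> {t}"
    using l by (auto simp: layout_def intro: less_trans)
  note Gord = G(3,4,5) and Gside = G(1-5)
  have gG: "g \<in> G" using cm g G by auto
  have lo: "{h\<in>G. (if g < m then 0 else if g = m then c else m) \<le> h \<and> h \<le> g} = {h\<in>insert m V. h \<le> g}" using cm g G by auto
  have hi: "{h\<in>G. g \<le> h \<and> (if g < m then m else t) \<le> h} = {t}" using cm g G by auto
  have *: "next_gaps g G K H = {h\<in>insert m V. h \<le> g} \<union> Suc ` {t} \<and>
      thresholds_R g (Suc t) (next_gaps g G K H) (next_kills_below g K) (next_kills_above t g H)"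
    by (rule thresholds_next[OF th gG refl lo hi]) (use cm g Gord in auto)
  show ?thesis
    unfolding fits.simps
    by (rule exI[of _ "{h\<in>insert m V. h \<le> g}"], rule exI[of _ "g"])
      (use conjunct1[OF *] conjunct2[OF *] cm g Gside in \<open>auto simp: card_insert_if card_image\<close>)
qed

lemma X_insert_top:
  assumes l: "layout L m V t G" and th: "thresholds_X c m t G K H" and cm: "c \<le> m"
  shows "next_fits (W (Suc (card V)) 0) t t G K H"
proof -
  have G: "finite L" "finite V" "\<forall>x\<in>L. x < m \<and> x < t" "\<forall>x\<in>V. m < x \<and> x < t" "m < t"
    "G = L \<union> {m} \<union> V \<union> {t}"
    using l by (auto simp: layout_def intro: less_trans)
  note Gord = G(3,4,5) and Gside = G(1-5)
  have gG: "t \<in> G" using cm G by auto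
  have lo: "{h\<in>G. (if t < m then 0 else if t = m then c else m) \<le> h \<and> h \<le> t} = (insert m (insert t V))" using cm G by auto
  have hi: "{h\<in>G. t \<le> h \<and> (if t < m then m else t) \<le> h} = {t}" using cm G by auto
  have *: "next_gaps t G K H = (insert m (insert t V)) \<union> Suc ` {t} \<and>
      thresholds_W t (Suc t) (next_gaps t G K H) (next_kills_below t K) (next_kills_above t t H)"
    by (rule thresholds_next[OF th gG refl lo hi]) (use cm Gord in auto)
  have lay: "layout (insert m V) t {} (Suc t) (next_gaps t G K H)"
    unfolding conjunct1[OF *] using cm G by (auto simp: layout_def)
  show ?thesis
    unfolding fits.simps
    by (rule exI[of _ "insert m V"], rule exI[of _ "t"], rule exI[of _ "{}"])
      (use lay conjunct1[OF *] conjunct2[OF *] cm Gside in \<open>auto simp: card_insert_if card_image\<close>)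
qed

text \<open>The upper half of \<open>m\<close> and all of \<open>U\<close> below \<open>l\<close>
  die, so \<open>j\<close> drops to 1 whatever it was.\<close>

lemma P_insert_bottom:
  assumes G: "finite U" "G = {m} \<union> U \<union> {t}" "\<forall>x\<in>U. m < x \<and> x \<le> l \<and> x < t" "l \<in> U" "m < l \<and> l < t \<and> m < t"
    and th: "thresholds_P m l t G K H"
  shows "next_fits (P 1) m t G K H"
proof -
  note Gord = G(3,4,5) and Gside = G(1,3,4,5)
  have gG: "m \<in> G" using  G by auto
  have lo: "{h\<in>G. (if m = t then l else 0) \<le> h \<and> h \<le> m} = {m}" using  G by auto
  have hi: "{h\<in>G. m \<le> h \<and> (if m = m then l else t) \<le> h} = {l, t}" using  G by auto
  have *: "next_gaps m G K H = {m} \<union> Suc ` {l, t} \<and>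
      thresholds_P m (Suc l) (Suc t) (next_gaps m G K H) (next_kills_below m K) (next_kills_above t m H)"
    by (rule thresholds_next[OF th gG refl lo hi]) (use  Gord in auto)
  show ?thesis
    unfolding fits.simps
    by (rule exI[of _ "m"], rule exI[of _ "{Suc l}"], rule exI[of _ "Suc l"])
      (use conjunct1[OF *] conjunct2[OF *]  Gside in \<open>auto simp: card_insert_if card_image\<close>)
qed

lemma P_insert_mid:
  assumes G: "finite U" "G = {m} \<union> U \<union> {t}" "\<forall>x\<in>U. m < x \<and> x \<le> l \<and> x < t" "l \<in> U" "m < l \<and> l < t \<and> m < t"
    and th: "thresholds_P m l t G K H" and g: "g \<in> U" "g < l"
  shows "next_fits (R (card {h\<in>insert m U. h \<le> g})) g t G K H"
proof -
  note Gord = G(3,4,5) and Gside = G(1,3,4,5)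
  have gG: "g \<in> G" using g G by auto
  have lo: "{h\<in>G. (if g = t then l else 0) \<le> h \<and> h \<le> g} = {h\<in>insert m U. h \<le> g}" using g G by auto
  have hi: "{h\<in>G. g \<le> h \<and> (if g = m then l else t) \<le> h} = {t}" using g G by auto
  have *: "next_gaps g G K H = {h\<in>insert m U. h \<le> g} \<union> Suc ` {t} \<and>
      thresholds_R (Suc t) (Suc t) (next_gaps g G K H) (next_kills_below g K) (next_kills_above t g H)"
    by (rule thresholds_next[OF th gG refl lo hi]) (use g Gord in auto)
  show ?thesis
    unfolding fits.simps
    by (rule exI[of _ "{h\<in>insert m U. h \<le> g}"])
      (use conjunct1[OF *] conjunct2[OF *] g Gside in \<open>auto simp: card_insert_if card_image\<close>)
qed

lemma P_insert_max:
  assumes G: "finite U" "G = {m} \<union> U \<union> {t}" "\<forall>x\<in>U. m < x \<and> x \<le> l \<and> x < t" "l \<in> U" "m < l \<and> l < t \<and> m < t"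
    and th: "thresholds_P m l t G K H"
  shows "next_fits (P (card U)) l t G K H"
proof -
  note Gord = G(3,4,5) and Gside = G(1,3,4,5)
  have gG: "l \<in> G" using  G by auto
  have lo: "{h\<in>G. (if l = t then l else 0) \<le> h \<and> h \<le> l} = (insert m U)" using  G by auto
  have hi: "{h\<in>G. l \<le> h \<and> (if l = m then l else t) \<le> h} = {t}" using  G by auto
  have *: "next_gaps l G K H = (insert m U) \<union> Suc ` {t} \<and>
      thresholds_P m l (Suc t) (next_gaps l G K H) (next_kills_below l K) (next_kills_above t l H)"
    by (rule thresholds_next[OF th gG refl lo hi]) (use  Gord in auto)
  show ?thesis
    unfolding fits.simps
    by (rule exI[of _ "m"], rule exI[of _ "U"], rule exI[of _ "l"])
      (use conjunct1[OF *] conjunct2[OF *]  Gside in \<open>auto simp: card_insert_if card_image\<close>)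
qed

lemma P_insert_top:
  assumes G: "finite U" "G = {m} \<union> U \<union> {t}" "\<forall>x\<in>U. m < x \<and> x \<le> l \<and> x < t" "l \<in> U" "m < l \<and> l < t \<and> m < t"
    and th: "thresholds_P m l t G K H"
  shows "next_fits (W 1 0) t t G K H"
proof -
  note Gord = G(3,4,5) and Gside = G(1,3,4,5)
  have gG: "t \<in> G" using  G by auto
  have lo: "{h\<in>G. (if t = t then l else 0) \<le> h \<and> h \<le> t} = {l, t}" using  G by auto
  have hi: "{h\<in>G. t \<le> h \<and> (if t = m then l else t) \<le> h} = {t}" using  G by auto
  have *: "next_gaps t G K H = {l, t} \<union> Suc ` {t} \<and>
      thresholds_W t (Suc t) (next_gaps t G K H) (next_kills_below t K) (next_kills_above t t H)"
    by (rule thresholds_next[OF th gG refl lo hi]) (use  Gord in auto)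
  have lay: "layout {l} t {} (Suc t) (next_gaps t G K H)"
    unfolding conjunct1[OF *] using  G by (auto simp: layout_def)
  show ?thesis
    unfolding fits.simps
    by (rule exI[of _ "{l}"], rule exI[of _ "t"], rule exI[of _ "{}"])
      (use lay conjunct1[OF *] conjunct2[OF *]  Gside in \<open>auto simp: card_insert_if card_image\<close>)
qed

text \<open>As before, \<open>c\<close> is left free to cover \<open>R\<close> (with
  \<open>c = t\<close>) and \<open>Y\<close> (with \<open>c = l\<close>). Because
  \<open>g < c\<close>, a later insertion at the top kills every remaining lower gap.\<close>

lemma R_insert_below:
  assumes G: "finite L" "G = L \<union> {t}" "\<forall>x\<in>L. x < t \<and> x \<le> t"
    and th: "thresholds_R c t G K H" and g: "g \<in> L" "g < c" and cm: "c \<le> t"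
  shows "next_fits (R (card {h\<in>L. h \<le> g})) g t G K H"
proof -
  note Gord = G(3) and Gside = G(1,3)
  have gG: "g \<in> G" using cm g G by auto
  have lo: "{h\<in>G. (if g = t then c else 0) \<le> h \<and> h \<le> g} = {h\<in>L. h \<le> g}" using cm g G by auto
  have hi: "{h\<in>G. g \<le> h \<and> t \<le> h} = {t}" using cm g G by auto
  have *: "next_gaps g G K H = {h\<in>L. h \<le> g} \<union> Suc ` {t} \<and>
      thresholds_R (Suc t) (Suc t) (next_gaps g G K H) (next_kills_below g K) (next_kills_above t g H)"
    by (rule thresholds_next[OF th gG refl lo hi]) (use cm g Gord in auto)
  show ?thesis
    unfolding fits.simps
    by (rule exI[of _ "{h\<in>L. h \<le> g}"])
      (use conjunct1[OF *] conjunct2[OF *] cm g Gside in \<open>auto simp: card_insert_if card_image\<close>)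
qed

lemma R_insert_top:
  assumes G: "finite L" "G = L \<union> {t}" "\<forall>x\<in>L. x < t \<and> x \<le> t"
    and th: "thresholds_R t t G K H"
  shows "next_fits (W 0 0) t t G K H"
proof -
  note Gord = G(3) and Gside = G(1,3)
  have gG: "t \<in> G" using  G by auto
  have lo: "{h\<in>G. (if t = t then t else 0) \<le> h \<and> h \<le> t} = {t}" using  G by auto
  have hi: "{h\<in>G. t \<le> h \<and> t \<le> h} = {t}" using  G by auto
  have *: "next_gaps t G K H = {t} \<union> Suc ` {t} \<and>
      thresholds_W t (Suc t) (next_gaps t G K H) (next_kills_below t K) (next_kills_above t t H)"
    by (rule thresholds_next[OF th gG refl lo hi]) (use  Gord in auto)
  have lay: "layout {} t {} (Suc t) (next_gaps t G K H)"
    unfolding conjunct1[OF *] using  G by (auto simp: layout_def)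
  show ?thesis
    unfolding fits.simps
    by (rule exI[of _ "{}"], rule exI[of _ "t"], rule exI[of _ "{}"])
      (use lay conjunct1[OF *] conjunct2[OF *]  Gside in \<open>auto simp: card_insert_if card_image\<close>)
qed

lemma Y_insert_max:
  assumes G: "finite L" "G = L \<union> {t}" "\<forall>x\<in>L. x < t \<and> x \<le> t"
    and th: "thresholds_R c t G K H" and c: "c \<in> L" "\<forall>x\<in>L. x \<le> c"
  shows "next_fits (Y (card L)) c t G K H"
proof -
  note Gord = G(3) and Gside = G(1,3)
  have gG: "c \<in> G" using c G by auto
  have lo: "{h\<in>G. (if c = t then c else 0) \<le> h \<and> h \<le> c} = L" using c G by auto
  have hi: "{h\<in>G. c \<le> h \<and> t \<le> h} = {t}" using c G by auto
  have *: "next_gaps c G K H = L \<union> Suc ` {t} \<and>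
      thresholds_R c (Suc t) (next_gaps c G K H) (next_kills_below c K) (next_kills_above t c H)"
    by (rule thresholds_next[OF th gG refl lo hi]) (use c Gord in auto)
  show ?thesis
    unfolding fits.simps
    by (rule exI[of _ "L"], rule exI[of _ "c"])
      (use conjunct1[OF *] conjunct2[OF *] c Gside in \<open>auto simp: card_insert_if card_image\<close>)
qed

lemma Y_insert_top:
  assumes G: "finite L" "G = L \<union> {t}" "\<forall>x\<in>L. x < t \<and> x \<le> t"
    and th: "thresholds_R c t G K H" and c: "c \<in> L" "\<forall>x\<in>L. x \<le> c"
  shows "next_fits (W 1 0) t t G K H"
proof -
  note Gord = G(3) and Gside = G(1,3)
  have gG: "t \<in> G" using c G by auto
  have lo: "{h\<in>G. (if t = t then c else 0) \<le> h \<and> h \<le> t} = {c, t}" using c G by auto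
  have hi: "{h\<in>G. t \<le> h \<and> t \<le> h} = {t}" using c G by auto
  have *: "next_gaps t G K H = {c, t} \<union> Suc ` {t} \<and>
      thresholds_W t (Suc t) (next_gaps t G K H) (next_kills_below t K) (next_kills_above t t H)"
    by (rule thresholds_next[OF th gG refl lo hi]) (use c Gord in auto)
  have lay: "layout {c} t {} (Suc t) (next_gaps t G K H)"
    unfolding conjunct1[OF *] using c G by (auto simp: layout_def)
  show ?thesis
    unfolding fits.simps
    by (rule exI[of _ "{c}"], rule exI[of _ "t"], rule exI[of _ "{}"])
      (use lay conjunct1[OF *] conjunct2[OF *] c Gside in \<open>auto simp: card_insert_if card_image\<close>)
qed

section \<open>Summing over the gaps of a state\<close>

lemma sum_rank_insert_min:
  fixes V :: "nat set" and F :: "nat \<Rightarrow> nat"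
  assumes "finite V" "\<forall>x\<in>V. m < x"
  shows "(\<Sum>g\<in>V. F (card {h\<in>insert m V. h \<le> g})) = (\<Sum>i=2..Suc (card V). F i)"
proof -
  \<comment> \<open>The extra minimum raises every rank by one, so the summation starts at
    2.\<close>
  have "card {h\<in>insert m V. h \<le> g} = Suc (card {h\<in>V. h \<le> g})" if "g \<in> V" for g
  proof -
    have "{h\<in>insert m V. h \<le> g} = insert m {h\<in>V. h \<le> g}" "m \<notin> {h\<in>V. h \<le> g}"
      using assms that by (auto intro: less_imp_le)
    then show ?thesis using assms by simp
  qed
  then have "(\<Sum>g\<in>V. F (card {h\<in>insert m V. h \<le> g})) = (\<Sum>g\<in>V. (F \<circ> Suc) (card {h\<in>V. h \<le> g}))"
    by simp
  also have "\<dots> = (\<Sum>i=1..card V. (F \<circ> Suc) i)" using assms(1) by (rule sum_rank)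
  also have "\<dots> = (\<Sum>i=2..Suc (card V). F i)"
    using sum.shift_bounds_cl_Suc_ivl[of F 1 "card V"] by (simp add: numeral_2_eq_2)
  finally show ?thesis .
qed

lemma sum_rank_remove_max:
  fixes L :: "nat set" and F :: "nat \<Rightarrow> nat"
  assumes "finite L" "l \<in> L" "\<forall>x\<in>L. x \<le> l"
  shows "(\<Sum>g\<in>L - {l}. F (card {h\<in>L. h \<le> g})) = (\<Sum>i=1..card L - 1. F i)"
proof -
  have "{h\<in>L. h \<le> g} = {h\<in>L - {l}. h \<le> g}" if "g \<in> L - {l}" for g
    using that assms by auto
  then have "(\<Sum>g\<in>L - {l}. F (card {h\<in>L. h \<le> g})) = (\<Sum>g\<in>L - {l}. F (card {h\<in>L - {l}. h \<le> g}))"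
    by simp
  also have "\<dots> = (\<Sum>i=1..card (L - {l}). F i)" using assms(1) by (intro sum_rank) simp
  finally show ?thesis using assms by simp
qed

text \<open>The induction hypothesis replaces each child by its label; the sum over \<open>G\<close>
  is then split into the pieces of the shape, and the rank lemmas turn each piece into the matching
  sum in \<open>count\<close>.\<close>

lemma extensions_eq_count:
  "fits f t G K H \<Longrightarrow> extensions n t G K H = count n f"
proof (induction n arbitrary: f t G K H)
  case (Suc n)
  define c where "c g = extensions n (Suc t) (next_gaps g G K H) (next_kills_below g K) (next_kills_above t g H)" for g
  have c: "c g = count n f'" if "next_fits f' g t G K H" for g f'
    using Suc.IH[OF that] by (simp add: c_def)
  have e: "extensions (Suc n) t G K H = (\<Sum>g\<in>G. c g)" by (simp add: c_def)
  have split: "(\<Sum>g\<in>G. c g) = (\<Sum>g\<in>L. c g) + c m + (\<Sum>g\<in>V. c g) + c t"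
    if "layout L m V t G" for L m V
  proof -
    have "L \<inter> V = {}" "m \<notin> L \<union> V" "t \<notin> L \<union> V \<union> {m}" "finite L" "finite V"
      "G = insert t (insert m (L \<union> V))"
      using that by (fastforce simp: layout_def)+
    then show ?thesis by (simp add: sum.union_disjoint)
  qed
  show ?case
  proof (cases f)
    case (W a b)
    with Suc.prems obtain L m V where *: "layout L m V t G" "card L = a" "card V = b" "thresholds_W m t G K H"
      by auto
    note ch = W_insert_below[OF *(1,4), THEN c] W_insert_above[OF *(1,4), THEN c]
      W_insert_mid[OF *(1,4), THEN c] W_insert_top[OF *(1,4), THEN c]
    have "finite L" "finite V" using *(1) by (auto simp: layout_def)
    then show ?thesis
      using sum_rank[of L "\<lambda>i. count n (X i b)"] sum_rank[of V "\<lambda>i. count n (P i)"] *(2,3)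
      by (simp del: extensions.simps add: e split[OF *(1)] ch W)
  next
    case (X a b)
    with Suc.prems obtain L l m V where *: "layout L m V t G" "card L = a" "card V = b"
      "l \<in> L" "\<forall>x\<in>L. x \<le> l" "thresholds_X l m t G K H"
      by auto
    have fin: "finite L" "finite V" "l \<le> m" "\<forall>x\<in>V. m < x"
      using * by (auto simp: layout_def intro: less_imp_le)
    have "c g = count n (Z (card {h\<in>L. h \<le> g}) b)" if "g \<in> L - {l}" for g
    proof -
      have "g < l" using that *(5) by (simp add: order.not_eq_order_implies_strict)
      then show ?thesis using X_insert_below[OF *(1,6) _ _ fin(3), THEN c, of g] that *(3) by simp
    qed
    then have "(\<Sum>g\<in>L. c g) = c l + (\<Sum>i=1..a - 1. count n (Z i b))"
      using sum_rank_remove_max[OF fin(1) *(4,5), of "\<lambda>i. count n (Z i b)"] *(2)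
      by (simp add: sum.remove[OF fin(1) *(4)])
    moreover note ch = X_insert_below_max[OF *(1,6,4,5), THEN c] X_insert_mid[OF *(1,6,4,5), THEN c]
      X_insert_above[OF *(1,6) _ fin(3), THEN c] X_insert_top[OF *(1,6) fin(3), THEN c]
    ultimately show ?thesis
      using sum_rank_insert_min[OF fin(2,4), of "\<lambda>i. count n (Y i)"] *(2,3)
      by (simp del: extensions.simps add: e split[OF *(1)] ch X)
  next
    case (Z a b)
    with Suc.prems obtain L m V where *: "layout L m V t G" "card L = a" "card V = b"
      "thresholds_X m m t G K H"
      by auto
    have fin: "finite L" "finite V" "\<forall>x\<in>V. m < x" "\<And>x. x \<in> L \<Longrightarrow> x < m"
      using * by (auto simp: layout_def)
    note ch = X_insert_below[OF *(1,4) _ fin(4) order.refl, THEN c] Z_insert_mid[OF *(1,4), THEN c]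
      X_insert_above[OF *(1,4) _ order.refl, THEN c] X_insert_top[OF *(1,4) order.refl, THEN c]
    have "(\<Sum>j=1..Suc b. count n (Y j)) = count n (Y 1) + (\<Sum>j=2..Suc b. count n (Y j))"
      by (simp add: sum.atLeast_Suc_atMost numeral_2_eq_2)
    then show ?thesis
      using sum_rank[OF fin(1), of "\<lambda>i. count n (Z i b)"]
        sum_rank_insert_min[OF fin(2,3), of "\<lambda>i. count n (Y i)"] *(2,3)
      by (simp del: extensions.simps add: e split[OF *(1)] ch Z)
  next
    case (P j)
    with Suc.prems obtain m U l where *: "finite U" "\<forall>x\<in>U. m < x \<and> x \<le> l" "l \<in> U" "l < t"
      "card U = j" "G = {m} \<union> U \<union> {t}" "thresholds_P m l t G K H"
      by auto
    have U: "\<forall>x\<in>U. m < x \<and> x \<le> l \<and> x < t" "m < l \<and> l < t \<and> m < t"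
      using * by (auto intro: le_less_trans less_trans)
    note A = *(1,6) U(1) *(3) U(2) *(7)
    \<comment> \<open>Removing \<open>l\<close> does not change the ranks below it, while
      \<open>m\<close> always counts; hence these labels run from \<open>R 2\<close> to
      \<open>R j\<close>.\<close>
    have "c g = count n (R (card {h\<in>insert m (U - {l}). h \<le> g}))" if g: "g \<in> U - {l}" for g
    proof -
      have "g < l" using g U by auto
      moreover from this have "{h\<in>insert m U. h \<le> g} = {h\<in>insert m (U - {l}). h \<le> g}" 
        using U(2) by auto
      ultimately show ?thesis using P_insert_mid[OF A, of g, THEN c] g by simp
    qed
    then have "(\<Sum>g\<in>U. c g) = c l + (\<Sum>i=2..Suc (card (U - {l})). count n (R i))"
      using sum_rank_insert_min[of "U - {l}" m "\<lambda>i. count n (R i)"] *(1) U(1)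
      by (simp add: sum.remove[OF *(1,3)])
    moreover have "Suc (card (U - {l})) = j" using *(1,3,5) by (metis card.remove)
    moreover have "(\<Sum>g\<in>G. c g) = c m + (\<Sum>g\<in>U. c g) + c t"
    proof -
      have "m \<notin> U" "t \<notin> U" "m \<noteq> t" using U by auto
      then show ?thesis using *(1,6) by simp
    qed
    moreover note ch = P_insert_bottom[OF A, THEN c] P_insert_max[OF A, THEN c] P_insert_top[OF A, THEN c]
    ultimately show ?thesis using *(5) by (simp del: extensions.simps add: e P)
  next
    case (R a)
    with Suc.prems obtain L where *: "finite L" "\<forall>x\<in>L. x < t" "card L = a" "G = L \<union> {t}"
      "thresholds_R t t G K H"
      by auto
    have L: "\<forall>x\<in>L. x < t \<and> x \<le> t" "\<And>x. x \<in> L \<Longrightarrow> x < t" "t \<notin> L" using *(2) by auto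
    note ch = R_insert_below[OF *(1,4) L(1) *(5) _ L(2) order.refl, THEN c]
      R_insert_top[OF *(1,4) L(1) *(5), THEN c]
    have "(\<Sum>g\<in>G. c g) = (\<Sum>g\<in>L. c g) + c t" using L(3) *(1,4) by simp
    then show ?thesis
      using sum_rank[OF *(1), of "\<lambda>i. count n (R i)"] *(3) by (simp del: extensions.simps add: e ch R)
  next
    case (Y a)
    with Suc.prems obtain L l where *: "finite L" "\<forall>x\<in>L. x \<le> l" "l \<in> L" "l < t" "card L = a"
      "G = L \<union> {t}" "thresholds_R l t G K H"
      by auto
    have L: "\<forall>x\<in>L. x < t \<and> x \<le> t" "t \<notin> L" "l \<le> t" using *(2,4) by fastforce+
    have "c g = count n (R (card {h\<in>L. h \<le> g}))" if "g \<in> L - {l}" for g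
    proof -
      have "g < l" using that *(2) by (simp add: order.not_eq_order_implies_strict)
      then show ?thesis using R_insert_below[OF *(1,6) L(1) *(7) _ _ L(3), THEN c, of g] that by simp
    qed
    then have "(\<Sum>g\<in>L. c g) = c l + (\<Sum>i=1..a - 1. count n (R i))"
      using sum_rank_remove_max[OF *(1,3,2), of "\<lambda>i. count n (R i)"] *(5)
      by (simp add: sum.remove[OF *(1,3)])
    moreover have "(\<Sum>g\<in>G. c g) = (\<Sum>g\<in>L. c g) + c t" using L(2) *(1,6) by simp
    moreover note ch = Y_insert_max[OF *(1,6) L(1) *(7,3,2), THEN c]
      Y_insert_top[OF *(1,6) L(1) *(7,3,2), THEN c]
    ultimately show ?thesis using *(5) by (simp del: extensions.simps add: e Y)
  qed
qed simp

section \<open>Avoiders as nodes of the generating tree\<close>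

lemma all_less_4: "(\<forall>i<4. Q i) \<longleftrightarrow> Q 0 \<and> Q 1 \<and> Q 2 \<and> Q (3 :: nat)"
  by (simp add: numeral_eq_Suc All_less_Suc conj_ac)

lemma order_isomorphic_length4:
  "order_isomorphic \<sigma> [p, q, r, s] \<longleftrightarrow> (\<exists>a b c d. \<sigma> = [a, b, c, d] \<and>
     (a < b \<longleftrightarrow> p < q) \<and> (a < c \<longleftrightarrow> p < r) \<and> (a < d \<longleftrightarrow> p < s) \<and>
     (b < a \<longleftrightarrow> q < p) \<and> (b < c \<longleftrightarrow> q < r) \<and> (b < d \<longleftrightarrow> q < s) \<and>
     (c < a \<longleftrightarrow> r < p) \<and> (c < b \<longleftrightarrow> r < q) \<and> (c < d \<longleftrightarrow> r < s) \<and>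
     (d < a \<longleftrightarrow> s < p) \<and> (d < b \<longleftrightarrow> s < q) \<and> (d < c \<longleftrightarrow> s < r))"
proof (cases "length \<sigma> = 4")
  case True
  then obtain a b c d where \<sigma>: "\<sigma> = [a, b, c, d]"
    by (auto simp: length_Suc_conv numeral_eq_Suc)
  have "length [a, b, c, d] = 4" "length [p, q, r, s] = 4" by simp_all
  then show ?thesis
    unfolding order_isomorphic_def \<sigma> by (simp only: all_less_4) simp
next
  case False
  then have "\<not> order_isomorphic \<sigma> [p, q, r, s]" by (simp add: order_isomorphic_def)
  moreover have "\<sigma> \<noteq> [a, b, c, d]" for a b c d using False by auto
  ultimately show ?thesis by simp
qed

definition patterns :: "nat list set" where
  "patterns = {[1, 4, 3, 2], [2, 1, 4, 3], [3, 2, 1, 4]}"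

text \<open>In each pattern a chain of three strict inequalities already determines all twelve
  comparisons.\<close>

lemma avoids_patterns_iff: "(\<forall>\<tau>\<in>patterns. avoids \<pi> \<tau>) \<longleftrightarrow> good \<pi>"
proof -
  have "order_isomorphic \<sigma> [1, 4, 3, 2] \<longleftrightarrow> (\<exists>a b c d. \<sigma> = [a, b, c, d] \<and> a < d \<and> d < c \<and> c < b)" for \<sigma>
    unfolding order_isomorphic_length4 by (intro ex_cong1) auto
  then have 1: "avoids \<pi> [1, 4, 3, 2] \<longleftrightarrow>
      \<not> (\<exists>a b c d. subseq [a, b, c, d] \<pi> \<and> a < d \<and> d < c \<and> c < b)"
    unfolding avoids_def by metis
  have "order_isomorphic \<sigma> [2, 1, 4, 3] \<longleftrightarrow> (\<exists>a b c d. \<sigma> = [a, b, c, d] \<and> b < a \<and> a < d \<and> d < c)" for \<sigma>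
    unfolding order_isomorphic_length4 by (intro ex_cong1) auto
  then have 2: "avoids \<pi> [2, 1, 4, 3] \<longleftrightarrow>
      \<not> (\<exists>a b c d. subseq [a, b, c, d] \<pi> \<and> b < a \<and> a < d \<and> d < c)"
    unfolding avoids_def by metis
  have "order_isomorphic \<sigma> [3, 2, 1, 4] \<longleftrightarrow> (\<exists>a b c d. \<sigma> = [a, b, c, d] \<and> c < b \<and> b < a \<and> a < d)" for \<sigma>
    unfolding order_isomorphic_length4 by (intro ex_cong1) auto
  then have 3: "avoids \<pi> [3, 2, 1, 4] \<longleftrightarrow>
      \<not> (\<exists>a b c d. subseq [a, b, c, d] \<pi> \<and> c < b \<and> b < a \<and> a < d)"
    unfolding avoids_def by metis
  show ?thesis
    unfolding good_def bad_def patterns_def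
    by (simp only: ball_simps 1 2 3 conj_disj_distribL ex_disj_distrib de_Morgan_disj simp_thms)
qed

lemma avoiders_iff: "\<pi> \<in> avoiders n patterns \<longleftrightarrow> set \<pi> = {1..n} \<and> distinct \<pi> \<and> good \<pi>"
  unfolding avoiders_def avoids_patterns_iff by (auto simp: permutations_of_set_def)

lemma length_avoider: "\<pi> \<in> avoiders n patterns \<Longrightarrow> length \<pi> = n"
  by (auto simp: avoiders_iff dest: distinct_card)

lemma finite_avoiders: "finite (avoiders n patterns)"
  by (simp add: avoiders_def)

lemma inj_on_insert_front: "inj_on (\<lambda>(\<pi>, g). insert_front g \<pi>) A"
  by (auto simp: inj_on_def insert_front_def inj_map_eq_map[OF inj_shift])

lemma shift_image: "g \<le> n \<Longrightarrow> insert (Suc g) (shift g ` {1..n}) = {1..Suc n}"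
proof -
  assume g: "g \<le> n"
  have "x \<in> insert (Suc g) (shift g ` {1..n})" if "x \<in> {1..Suc n}" for x
  proof -
    consider "x \<le> g" | "x = Suc g" | y where "x = Suc y" "g < y" by (cases x) force+
    then show ?thesis
    proof cases
      case 1
      then have "x = shift g x" "x \<in> {1..n}" using that g by (auto simp: shift_def)
      then show ?thesis by blast
    next
      case 3
      then have "x = shift g y" "y \<in> {1..n}" using that by (auto simp: shift_def)
      then show ?thesis by blast
    qed simp
  qed
  then have "{1..Suc n} \<subseteq> insert (Suc g) (shift g ` {1..n})" by blast
  moreover have "insert (Suc g) (shift g ` {1..n}) \<subseteq> {1..Suc n}" using g by (auto simp: shift_def)
  ultimately show ?thesis by (rule equalityI[rotated])
qed

text \<open>For surjectivity, delete the first letter \<open>Suc g\<close> and undo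
  \<open>shift g\<close> on the rest; \<open>good_insert_front\<close> then yields at once that the
  rest avoids the patterns and that \<open>g\<close> was allowed.\<close>

lemma image_insert_front:
  "(\<lambda>(\<pi>, g). insert_front g \<pi>) ` (SIGMA \<pi>:avoiders n patterns. gaps \<pi>) = avoiders (Suc n) patterns"
proof (intro equalityI subsetI)
  fix \<rho> assume "\<rho> \<in> (\<lambda>(\<pi>, g). insert_front g \<pi>) ` (SIGMA \<pi>:avoiders n patterns. gaps \<pi>)"
  then obtain \<pi> g where *: "\<rho> = insert_front g \<pi>" "\<pi> \<in> avoiders n patterns" "g \<in> gaps \<pi>" by auto
  then have "g \<le> n" using length_avoider by (auto simp: gaps_def)
  then show "\<rho> \<in> avoiders (Suc n) patterns"
    using * length_avoider[OF *(2)] shift_image[of g n] good_insert_front[of g \<pi>]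
    by (auto simp: avoiders_iff insert_front_def distinct_map inj_on_def shift_def split: if_splits)
next
  fix \<rho> assume \<rho>: "\<rho> \<in> avoiders (Suc n) patterns"
  then obtain v \<tau> where v: "\<rho> = v # \<tau>" by (cases \<rho>) (auto simp: avoiders_iff)
  have "set \<rho> = {1..Suc n}" "distinct \<rho>" using \<rho> by (simp_all add: avoiders_iff)
  moreover have "v \<in> set \<rho>" using v by simp
  ultimately have v': "v \<noteq> 0" "v \<le> Suc n" "v \<notin> set \<tau>" "distinct \<tau>" "insert v (set \<tau>) = {1..Suc n}"
    using v by simp_all
  then obtain g where g: "v = Suc g" "g \<le> n" by (cases v) auto
  have "insert v (shift g ` {1..n}) = insert v (set \<tau>)" using shift_image[OF g(2)] v'(5) by (simp only: g(1))
  moreover have "v \<notin> shift g ` {1..n}" by (auto simp: g shift_def split: if_splits)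
  ultimately have set_\<tau>: "set \<tau> = shift g ` {1..n}" using v'(3) by auto
  then have "\<tau> \<in> map (shift g) ` lists {1..n}" by (auto simp flip: lists_image)
  then obtain \<pi> where \<pi>: "\<tau> = map (shift g) \<pi>" "set \<pi> \<subseteq> {1..n}" by auto
  have "set \<pi> = {1..n}"
    using set_\<tau> inj_image_eq_iff[OF inj_shift] unfolding \<pi>(1) set_map by metis
  moreover have "distinct \<pi>" using v'(4) \<pi> by (simp add: distinct_map)
  moreover have \<rho>_eq: "\<rho> = insert_front g \<pi>" using v g \<pi> by (simp add: insert_front_def)
  moreover have "length \<pi> = n" using calculation by (metis card_atLeastAtMost diff_Suc_1 distinct_card)
  ultimately have "\<pi> \<in> avoiders n patterns" "g \<in> gaps \<pi>"
    using \<rho> good_insert_front[of g \<pi>] g by (auto simp: avoiders_iff)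
  then show "\<rho> \<in> (\<lambda>(\<pi>, g). insert_front g \<pi>) ` (SIGMA \<pi>:avoiders n patterns. gaps \<pi>)"
    using \<rho>_eq by force
qed

lemma finite_gaps: "finite (gaps \<pi>)"
  by (simp add: gaps_def)

text \<open>The length \<open>k\<close> varies in the induction, because one step trades the gaps of
  all avoiders of length \<open>k\<close> for the avoiders of length \<open>Suc k\<close>. For
  \<open>k = 1\<close> the sum has a single term, the root.\<close>

lemma sum_extensions_avoiders:
  "(\<Sum>\<pi>\<in>avoiders k patterns. extensions m k (gaps \<pi>) (kills_below \<pi>) (kills_above \<pi>)) = card (avoiders (k + m) patterns)"
proof (induction m arbitrary: k)
  case (Suc m)
  have "(\<Sum>\<pi>\<in>avoiders k patterns. extensions (Suc m) k (gaps \<pi>) (kills_below \<pi>) (kills_above \<pi>)) =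
      (\<Sum>\<pi>\<in>avoiders k patterns. \<Sum>g\<in>gaps \<pi>. extensions m (Suc k)
         (gaps (insert_front g \<pi>)) (kills_below (insert_front g \<pi>)) (kills_above (insert_front g \<pi>)))"
  proof (intro sum.cong refl)
    fix \<pi> assume \<pi>: "\<pi> \<in> avoiders k patterns"
    then have set: "set \<pi> = {1..k}" and len: "length \<pi> = k" by (auto simp: avoiders_iff length_avoider)
    have "gaps (insert_front g \<pi>) = next_gaps g (gaps \<pi>) (kills_below \<pi>) (kills_above \<pi>) \<and>
        kills_below (insert_front g \<pi>) = next_kills_below g (kills_below \<pi>) \<and> kills_above (insert_front g \<pi>) = next_kills_above k g (kills_above \<pi>)"
      if "g \<in> gaps \<pi>" for g
    proof -
      have "g \<le> k" using that len by (simp add: gaps_def)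
      then show ?thesis
        using gaps_insert_front[of g \<pi>] kills_below_insert_front[OF set] kills_above_insert_front[OF set] len by blast
    qed
    then show "extensions (Suc m) k (gaps \<pi>) (kills_below \<pi>) (kills_above \<pi>) = (\<Sum>g\<in>gaps \<pi>. extensions m (Suc k)
         (gaps (insert_front g \<pi>)) (kills_below (insert_front g \<pi>)) (kills_above (insert_front g \<pi>)))"
      by simp
  qed
  also have "\<dots> = (\<Sum>(\<pi>, g)\<in>(SIGMA \<pi>:avoiders k patterns. gaps \<pi>). extensions m (Suc k)
         (gaps (insert_front g \<pi>)) (kills_below (insert_front g \<pi>)) (kills_above (insert_front g \<pi>)))"
    by (rule sum.Sigma) (auto simp: finite_avoiders finite_gaps)
  also have "\<dots> = (\<Sum>\<rho>\<in>avoiders (Suc k) patterns. extensions m (Suc k) (gaps \<rho>) (kills_below \<rho>) (kills_above \<rho>))"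
    unfolding image_insert_front[symmetric]
    by (subst sum.reindex[OF inj_on_insert_front]) (auto intro!: sum.cong)
  also have "\<dots> = card (avoiders (Suc k + m) patterns)" by (rule Suc.IH)
  finally show ?case by simp
qed simp

lemma set_eq_singletonD: "set \<pi> = {a} \<Longrightarrow> distinct \<pi> \<Longrightarrow> \<pi> = [a]"
  by (cases \<pi>; cases "tl \<pi>") auto

lemma card_avoiders_Suc: "card (avoiders (Suc m) patterns) = count m (W 0 0)"
proof -
  have "good [1]" by (auto simp: good_def)
  then have "avoiders 1 patterns = {[1]}"
    by (auto simp: avoiders_iff set_eq_singletonD)
  moreover have "gaps [1] = {0, 1}" by (auto simp: gaps_def)
  moreover have "\<not> kills_below [1] k h" "\<not> kills_above [1] k h" for k h by (auto simp: kills_below_def kills_above_def)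
  then have fits: "fits (W 0 0) 1 {0, 1} (kills_below [1]) (kills_above [1])"
    unfolding fits.simps
    \<comment> \<open>The root \<open>[1]\<close> has just the gaps \<open>m = 0\<close> and
      \<open>t = 1\<close>.\<close>
    by (intro exI[of _ "{}"] exI[of _ 0]) (auto simp: layout_def thresholds_def)
  ultimately show ?thesis
    using sum_extensions_avoiders[of m 1] extensions_eq_count[OF fits, of m] by simp
qed

lemma card_avoiders_0: "card (avoiders 0 patterns) = 1"
proof -
  have "avoiders 0 patterns = {[]}" by (auto simp: avoiders_iff good_def)
  then show ?thesis by simp
qed

section \<open>Generating functions\<close>

text \<open>Denominators are cleared throughout, so that only polynomial identities and cancellation
  in an integral domain are needed. Everything is expressed through \<open>q\<close> and
  \<open>u\<close>, the unknowns \<open>F0\<close> and \<open>F1\<close> of the application.\<close>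

lemma linear_system_solution:
  fixes x :: "'a::idom"
  assumes nz: "1 - x \<noteq> 0" "1 - 2*x \<noteq> 0" "1 - 3*x \<noteq> 0" "1 - 4*x + 6*x^2 - 5*x^3 + x^4 \<noteq> 0"
    and v: "v * ((1 - x) * (1 - 2*x)) = x * u"
    and D: "D * (1 - x)^2 = x^2 * v"
    and E: "E * (1 - x)^3 = x * (1 - x)^2 * v - x^2 * q"
    and K: "K * (1 - x)^2 = x * (1 - x) * E - x * u"
    and B: "B * (1 - x)^2 = x * (u - q) + x * (1 - x) * D"
    and A: "A * (1 - x)^2 = x * (1 - x) * B + (1 - x) - (1 - x) * q + x * (1 - x) * K + x * (u - q)
        + x * (1 - x) * D"
    and C: "C * (1 - 3*x) = q + x * A"
    and q: "q = 1 + x * (A + C + K)"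
    and w: "w * (1 - x) = A + C + (1 - x) * D + (1 - x) * K"
    and u: "u = 1 + x * w"
  shows "q * (1 - 11*x + 51*x^2 - 132*x^3 + 209*x^4 - 208*x^5 + 128*x^6 - 44*x^7 + 5*x^8) =
    (1 - x)^4 * (1 - 6*x + 12*x^2 - 9*x^3 + x^4)"
proof -
  have D': "D * ((1 - x)^3 * (1 - 2*x)) = x^3 * u"
    using v D by algebra
  have E': "E * ((1 - x)^3 * (1 - 2*x)) = x^2 * (1 - x) * u - x^2 * (1 - 2*x) * q"
    using v E by algebra
  have K': "K * ((1 - x)^4 * (1 - 2*x)) = (- x + 3*x^2 - x^3) * (1 - x) * u - x^3 * (1 - 2*x) * q"
    using E' K by algebra
  have B': "B * ((1 - x)^4 * (1 - 2*x)) = (x - 4*x^2 + 5*x^3 - x^4) * u - x * (1 - x)^2 * (1 - 2*x) * q"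
    using D' B by algebra
  have A': "A * ((1 - x)^5 * (1 - 2*x)) = (1 - x)^4 * (1 - 2*x)
      + (- 1 + 3*x - 4*x^2 + 3*x^3 - 2*x^4) * (1 - 2*x) * q
      + (x - 5*x^2 + 9*x^3 - 5*x^4 + x^5) * u"
  proof -
    have "A * ((1 - x)^5 * (1 - 2*x)) = (A * (1 - x)^2) * ((1 - x)^3 * (1 - 2*x))" by algebra
    also have "\<dots> = x * (B * ((1 - x)^4 * (1 - 2*x))) + x * (K * ((1 - x)^4 * (1 - 2*x)))
        + x * (1 - x) * (D * ((1 - x)^3 * (1 - 2*x)))
        + ((1 - x) - (1 - x) * q + x * (u - q)) * ((1 - x)^3 * (1 - 2*x))"
      unfolding A by algebra
    finally show ?thesis unfolding B' K' D' by algebra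
  qed
  \<comment> \<open>\<open>A\<close> and \<open>C\<close> enter the two final equations only through
    their sum, and \<open>(1 - 3*x) * AC = (1 - 2*x) * A + q\<close>.\<close>
  define AC where "AC = A + C"
  have AC: "AC * ((1 - x)^5 * (1 - 2*x) * (1 - 3*x)) =
      (1 - 2*x) * (A * ((1 - x)^5 * (1 - 2*x))) + q * ((1 - x)^5 * (1 - 2*x))"
    unfolding AC_def using C by algebra
  have e1: "(1 - 3*x + x^2) * (1 - x)^4 * (1 - 2*x)
      + (- 1 + 8*x - 25*x^2 + 40*x^3 - 35*x^4 + 17*x^5 - 3*x^6) * (1 - 2*x) * q
      + (x^3 - 4*x^4 + 6*x^5 - 5*x^6 + x^7) * u = 0"
  proof -
    have "q * ((1 - x)^5 * (1 - 2*x) * (1 - 3*x)) = (1 - x)^5 * (1 - 2*x) * (1 - 3*x)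
        + x * (AC * ((1 - x)^5 * (1 - 2*x) * (1 - 3*x)))
        + x * (1 - x) * (1 - 3*x) * (K * ((1 - x)^4 * (1 - 2*x)))"
      by (subst q) (simp add: AC_def, algebra)
    then show ?thesis unfolding AC A' K' by algebra
  qed
  have e2: "(1 - 4*x + 5*x^2 - 3*x^3) * (1 - x)^4 * (1 - 2*x) + (2*x^5 - 4*x^6 + 3*x^7) * (1 - 2*x) * q
      + (- 1 + 11*x - 51*x^2 + 133*x^3 - 216*x^4 + 224*x^5 - 143*x^6 + 48*x^7 - 6*x^8) * u = 0"
  proof -
    have "u * ((1 - x)^6 * (1 - 2*x) * (1 - 3*x)) = (1 - x)^6 * (1 - 2*x) * (1 - 3*x)
        + x * (w * (1 - x)) * ((1 - x)^5 * (1 - 2*x) * (1 - 3*x))"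
      by (subst u) algebra
    also have "\<dots> = (1 - x)^6 * (1 - 2*x) * (1 - 3*x)
        + x * (AC * ((1 - x)^5 * (1 - 2*x) * (1 - 3*x)))
        + x * (1 - x)^3 * (1 - 3*x) * (D * ((1 - x)^3 * (1 - 2*x)))
        + x * (1 - x)^2 * (1 - 3*x) * (K * ((1 - x)^4 * (1 - 2*x)))"
      unfolding w by (simp add: AC_def, algebra)
    finally show ?thesis unfolding AC A' K' D' by algebra
  qed
  \<comment> \<open>Cramer's rule eliminates \<open>u\<close> from \<open>e1\<close> and
    \<open>e2\<close>. The result carries a spurious factor, cancelled by \<open>nz\<close>; its
    quartic is the coefficient of \<open>u\<close> in \<open>e1\<close> divided by
    \<open>x^3\<close>.\<close>
  have "((1 - x) * (1 - 2*x) * (1 - 3*x) * (1 - 4*x + 6*x^2 - 5*x^3 + x^4)) *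
      (q * (1 - 11*x + 51*x^2 - 132*x^3 + 209*x^4 - 208*x^5 + 128*x^6 - 44*x^7 + 5*x^8) -
       (1 - x)^4 * (1 - 6*x + 12*x^2 - 9*x^3 + x^4)) =
      (- 1 + 11*x - 51*x^2 + 133*x^3 - 216*x^4 + 224*x^5 - 143*x^6 + 48*x^7 - 6*x^8) *
        ((1 - 3*x + x^2) * (1 - x)^4 * (1 - 2*x)
          + (- 1 + 8*x - 25*x^2 + 40*x^3 - 35*x^4 + 17*x^5 - 3*x^6) * (1 - 2*x) * q
          + (x^3 - 4*x^4 + 6*x^5 - 5*x^6 + x^7) * u)
      - (x^3 - 4*x^4 + 6*x^5 - 5*x^6 + x^7) *
        ((1 - 4*x + 5*x^2 - 3*x^3) * (1 - x)^4 * (1 - 2*x) + (2*x^5 - 4*x^6 + 3*x^7) * (1 - 2*x) * q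
          + (- 1 + 11*x - 51*x^2 + 133*x^3 - 216*x^4 + 224*x^5 - 143*x^6 + 48*x^7 - 6*x^8) * u)"
    by algebra
  also have "\<dots> = 0" unfolding e1 e2 by simp
  finally have "q * (1 - 11*x + 51*x^2 - 132*x^3 + 209*x^4 - 208*x^5 + 128*x^6 - 44*x^7 + 5*x^8) -
       (1 - x)^4 * (1 - 6*x + 12*x^2 - 9*x^3 + x^4) = 0"
    using nz by (simp only: mult_eq_0_iff) blast
  then show ?thesis by simp
qed

section \<open>Geometric progressions with ratio \<open>lam\<close>\<close>

abbreviation z :: "rat fps" where "z \<equiv> fps_X"

definition lam :: "rat fps" where "lam = inverse (1 - z)"

lemma z_lam: "z * lam = lam - 1"
proof -
  have "lam * (1 - z) = 1" unfolding lam_def by (rule inverse_mult_eq_1) simp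
  then show ?thesis by (simp add: algebra_simps)
qed

lemma z_lam_left: "z * (lam * y) = lam * y - y"
  by (simp only: mult.assoc[symmetric] z_lam left_diff_distrib mult_1)

lemma z_lam_power: "z * lam ^ Suc c = lam ^ Suc c - lam ^ c"
  by (simp add: z_lam_left)

lemma solve_linear: "r = c + z * r \<Longrightarrow> r = lam * c"
  using z_lam by algebra

lemma geometric_solution:
  assumes "\<And>c. f (Suc c) = k + z * (\<Sum>i=1..Suc c. f i)"
  shows "z * (\<Sum>i=1..c. f i) = (lam ^ c - 1) * k" and "f (Suc c) = lam ^ Suc c * k"
proof -
  have step: "f (Suc c) = lam ^ Suc c * k" if "z * (\<Sum>i=1..c. f i) = (lam ^ c - 1) * k" for c
  proof -
    \<comment> \<open>The sum in the hypothesis contains \<open>f (Suc c)\<close> itself; isolating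
      that term produces one factor \<open>lam\<close> per step.\<close>
    have "f (Suc c) = (k + z * (\<Sum>i=1..c. f i)) + z * f (Suc c)"
      by (subst assms) (simp add: algebra_simps)
    from solve_linear[OF this] show ?thesis unfolding that by (simp add: algebra_simps)
  qed
  show sum: "z * (\<Sum>i=1..c. f i) = (lam ^ c - 1) * k"
  proof (induction c)
    case (Suc c)
    have "z * (\<Sum>i=1..Suc c. f i) = z * (\<Sum>i=1..c. f i) + (z * lam ^ Suc c) * k"
      using step[OF Suc] by (simp add: algebra_simps)
    also have "\<dots> = (lam ^ Suc c - 1) * k"
      unfolding Suc z_lam_power by (simp add: algebra_simps)
    finally show ?case .
  qed simp
  show "f (Suc c) = lam ^ Suc c * k" by (rule step[OF sum])
qed

section \<open>Generating functions of the shapes with one index\<close>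

definition gf :: "family \<Rightarrow> rat fps" where
  "gf f = Abs_fps (\<lambda>n. of_nat (count n f))"

lemma gf_eqI: "(\<And>n. of_nat (count (Suc n) f) = fps_nth S n) \<Longrightarrow> gf f = 1 + z * S"
proof (rule fps_ext)
  fix n
  assume "\<And>n. of_nat (count (Suc n) f) = fps_nth S n"
  then show "fps_nth (gf f) n = fps_nth (1 + z * S) n"
    by (cases n) (simp_all add: gf_def)
qed

lemma gf_rec:
  "gf (W a b) = 1 + z * ((\<Sum>i=1..a. gf (X i b)) + gf (W a (Suc b)) + (\<Sum>j=1..b. gf (P j)) + gf (W (Suc b) 0))"
  "gf (X a b) = 1 + z * ((\<Sum>i=1..a-1. gf (Z i b)) + gf (X a b) + gf (P 1) + (\<Sum>j=2..Suc b. gf (Y j))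
     + gf (W (Suc b) 0))"
  "gf (Z a b) = 1 + z * ((\<Sum>i=1..a. gf (Z i b)) + (\<Sum>j=1..Suc b. gf (Y j)) + gf (W (Suc b) 0))"
  "gf (P j) = 1 + z * (gf (P 1) + (\<Sum>i=2..j. gf (R i)) + gf (P j) + gf (W 1 0))"
  "gf (R c) = 1 + z * ((\<Sum>i=1..c. gf (R i)) + gf (W 0 0))"
  "gf (Y c) = 1 + z * ((\<Sum>i=1..c-1. gf (R i)) + gf (Y c) + gf (W 1 0))"
  by (rule gf_eqI, simp add: gf_def fps_sum_nth del: sum.cl_ivl_Suc)+

text \<open>This is the part of the recursion for \<open>R\<close> that does not depend on
  \<open>c\<close>, and it is also the series sought: the subtree of \<open>[1]\<close> together
  with the empty permutation. \<open>F1\<close> plays the first role for \<open>P\<close> and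
  \<open>Y\<close>.\<close>

definition F0 :: "rat fps" where "F0 = 1 + z * gf (W 0 0)"

definition F1 :: "rat fps" where "F1 = 1 + z * gf (W 1 0)"

text \<open>Since \<open>lam * F1 = gf (Y 1)\<close>, this is the difference between the children of
  \<open>X\<close> and of \<open>Z\<close> at the gap \<open>m\<close>.\<close>

definition F2 :: "rat fps" where "F2 = gf (P 1) - lam * F1"

lemma sum_2: "(\<Sum>i=2..Suc c. f i) = (\<Sum>i=1..Suc c. f i) - (f 1 :: rat fps)"
  using sum.atLeast_Suc_atMost[of 1 "Suc c" f] by (simp add: numeral_2_eq_2 del: sum.cl_ivl_Suc)

lemma gf_R: "z * (\<Sum>i=1..c. gf (R i)) = (lam ^ c - 1) * F0" "gf (R (Suc c)) = lam ^ Suc c * F0"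
proof -
  have "gf (R (Suc c)) = F0 + z * (\<Sum>i=1..Suc c. gf (R i))" for c
    by (subst gf_rec(5)) (simp add: F0_def algebra_simps del: sum.cl_ivl_Suc)
  from geometric_solution[of "\<lambda>c. gf (R c)", OF this]
  show "z * (\<Sum>i=1..c. gf (R i)) = (lam ^ c - 1) * F0" "gf (R (Suc c)) = lam ^ Suc c * F0" .
qed

lemma gf_Y: "gf (Y (Suc c)) = lam * (F1 - F0) + lam ^ Suc c * F0"
proof -
  have "gf (Y (Suc c)) = (F1 + z * (\<Sum>i=1..c. gf (R i))) + z * gf (Y (Suc c))"
    by (subst gf_rec(6)) (simp add: F1_def algebra_simps del: sum.cl_ivl_Suc)
  from solve_linear[OF this] show ?thesis unfolding gf_R by (simp add: algebra_simps)
qed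

lemma sum_gf_Y: "z * (\<Sum>j=1..b. gf (Y j)) = of_nat b * z * lam * (F1 - F0) + (lam ^ b - 1) * F0"
proof (induction b)
  case (Suc b)
  have "z * (\<Sum>j=1..Suc b. gf (Y j)) =
      z * (\<Sum>j=1..b. gf (Y j)) + z * lam * (F1 - F0) + (z * lam ^ Suc b) * F0"
    by (simp add: gf_Y algebra_simps)
  also have "\<dots> = of_nat (Suc b) * z * lam * (F1 - F0) + (lam ^ Suc b - 1) * F0"
    unfolding Suc z_lam_power by (simp add: algebra_simps)
  finally show ?case .
qed simp

lemma gf_P_1: "gf (P 1) = lam * (F1 + z * gf (P 1))"
  by (rule solve_linear, subst gf_rec(4)) (simp add: F1_def algebra_simps)

lemma gf_P: "gf (P (Suc j)) = gf (P 1) + lam * (lam ^ Suc j - lam) * F0"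
proof -
  have "z * (\<Sum>i=2..Suc j. gf (R i)) = (lam ^ Suc j - 1) * F0 - z * (lam * F0)"
    unfolding sum_2 right_diff_distrib gf_R(1) using gf_R(2)[of 0] by simp
  also have "\<dots> = (lam ^ Suc j - lam) * F0" unfolding z_lam_left by (simp add: algebra_simps)
  finally have R: "z * (\<Sum>i=2..Suc j. gf (R i)) = (lam ^ Suc j - lam) * F0" .
  have "gf (P (Suc j)) = (F1 + z * gf (P 1) + z * (\<Sum>i=2..Suc j. gf (R i))) + z * gf (P (Suc j))"
    by (subst gf_rec(4)) (simp add: F1_def algebra_simps del: sum.cl_ivl_Suc)
  from solve_linear[OF this]
  have "gf (P (Suc j)) = lam * (F1 + z * gf (P 1)) + lam * (lam ^ Suc j - lam) * F0"
    unfolding R by (simp add: algebra_simps)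
  then show ?thesis unfolding gf_P_1[symmetric] .
qed

lemma sum_gf_P:
  "z * (\<Sum>j=1..b. gf (P j)) = of_nat b * z * (gf (P 1) - lam ^ 2 * F0) + lam * (lam ^ b - 1) * F0"
proof (induction b)
  case (Suc b)
  have "z * (\<Sum>j=1..Suc b. gf (P j)) =
      z * (\<Sum>j=1..b. gf (P j)) + z * (gf (P 1) - lam ^ 2 * F0) + lam * (z * lam ^ Suc b) * F0"
    by (simp add: gf_P[of b, simplified] algebra_simps power2_eq_square)
  also have "\<dots> = of_nat (Suc b) * z * (gf (P 1) - lam ^ 2 * F0) + lam * (lam ^ Suc b - 1) * F0"
    unfolding Suc z_lam_power by (simp add: algebra_simps)
  finally show ?case .
qed simp

text \<open>The common inhomogeneous part of all \<open>Z a b\<close> for fixed \<open>b\<close>,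
  with the sum over \<open>Y\<close> evaluated; equivalently \<open>gf (Z 0 b)\<close>.\<close>

definition zeta :: "nat \<Rightarrow> rat fps" where
  "zeta b = 1 - F0 + of_nat (Suc b) * z * lam * (F1 - F0) + lam ^ Suc b * F0 + z * gf (W (Suc b) 0)"

lemma zeta: "1 + z * ((\<Sum>j=1..Suc b. gf (Y j)) + gf (W (Suc b) 0)) = zeta b"
  unfolding distrib_left sum_gf_Y zeta_def by (simp add: algebra_simps)

lemma gf_Z: "z * (\<Sum>i=1..a. gf (Z i b)) = (lam ^ a - 1) * zeta b"
proof -
  have "gf (Z (Suc a) b) = zeta b + z * (\<Sum>i=1..Suc a. gf (Z i b))" for a
    unfolding zeta[symmetric] by (rule trans[OF gf_rec(3)]) (simp only: distrib_left ac_simps)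
  from geometric_solution(1)[of "\<lambda>a. gf (Z a b)", OF this] show ?thesis .
qed

text \<open>Writing \<open>P 1\<close> as \<open>Y 1\<close> plus a correction completes the sum
  over \<open>Y\<close>. Apart from the correction \<open>X\<close> then obeys the recursion of
  \<open>Z\<close>, and the correction contributes the term with \<open>F2\<close>.\<close>

lemma gf_X: "gf (X (Suc a) b) = lam ^ Suc a * zeta b + lam * z * F2"
proof -
  have *: "gf (X (Suc a) b) = (z * (\<Sum>i=1..a. gf (Z i b)) + zeta b + z * (gf (P 1) - gf (Y 1)))
      + z * gf (X (Suc a) b)"
    unfolding zeta[symmetric]
    by (rule trans[OF gf_rec(2)]) (simp only: sum_2 diff_Suc_1 distrib_left right_diff_distrib algebra_simps)
  note eq = solve_linear[OF *]
  have "gf (Y 1) = lam * F1" using gf_Y[of 0] by (simp add: algebra_simps)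
  then show ?thesis unfolding eq gf_Z F2_def by (simp add: algebra_simps)
qed

lemma sum_gf_X: "z * (\<Sum>i=1..a. gf (X i b)) = (lam ^ a - 1) * zeta b + of_nat a * lam * z ^ 2 * F2"
proof (induction a)
  case (Suc a)
  have "z * (\<Sum>i=1..Suc a. gf (X i b)) =
      z * (\<Sum>i=1..a. gf (X i b)) + (z * lam ^ Suc a) * zeta b + lam * z ^ 2 * F2"
    by (simp add: gf_X algebra_simps power2_eq_square)
  also have "\<dots> = (lam ^ Suc a - 1) * zeta b + of_nat (Suc a) * lam * z ^ 2 * F2"
    unfolding Suc z_lam_power by (simp add: algebra_simps)
  finally show ?case .
qed simp

section \<open>The functional equation in two indices\<close>

lemma gf_W: "gf (W a b) = z * gf (W a (Suc b)) + lam ^ a * zeta b + of_nat a * lam * z ^ 2 * F2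
    + of_nat b * z * (F2 - z * lam ^ 2 * F0) - z * lam * F1"
proof -
  define L where "L = lam ^ b"
  define n :: "rat fps" where "n = of_nat b"
  define w where "w = z * gf (W (Suc b) 0)"
  have "gf (W a b) = 1 + z * (\<Sum>i=1..a. gf (X i b)) + z * gf (W a (Suc b)) + z * (\<Sum>j=1..b. gf (P j)) + w"
    by (subst gf_rec(1)) (simp add: w_def algebra_simps)
  then have "gf (W a b) = z * gf (W a (Suc b)) + lam ^ a * zeta b + of_nat a * lam * z ^ 2 * F2
      + (1 + n * z * (gf (P 1) - lam ^ 2 * F0) + lam * (L - 1) * F0 + w - zeta b)"
    unfolding sum_gf_X sum_gf_P by (simp add: L_def n_def algebra_simps)
  moreover have "zeta b = 1 - F0 + (n + 1) * z * lam * (F1 - F0) + lam * L * F0 + w"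
    by (simp add: zeta_def L_def n_def w_def algebra_simps)
  moreover have "gf (P 1) = F2 + lam * F1" by (simp add: F2_def)
  \<comment> \<open>The powers \<open>lam ^ b\<close> and the child \<open>W (Suc b) 0\<close> also
    occur in \<open>zeta b\<close> and cancel, which leaves an expression linear in
    \<open>b\<close>.\<close>
  moreover have "1 + n * z * ((F2 + lam * F1) - lam ^ 2 * F0) + lam * (L - 1) * F0 + w
      - (1 - F0 + (n + 1) * z * lam * (F1 - F0) + lam * L * F0 + w) = n * z * (F2 - z * lam ^ 2 * F0) - z * lam * F1"
    using z_lam by algebra
  ultimately show ?thesis unfolding n_def[symmetric] by (metis add_diff_eq)
qed

text \<open>Each value of \<open>f\<close> on the right carries a factor \<open>z\<close>, so a
  coefficient depends only on coefficients of lower degree, whatever the indices.\<close>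

lemma recurrence_unique:
  fixes f :: "nat \<Rightarrow> nat \<Rightarrow> rat fps"
  assumes f: "\<And>a b. f a b = z * f a (Suc b) + lam ^ a * (z * f (Suc b) 0)"
  shows "f a b = 0"
proof -
  have "fps_nth (f a b) n = 0" for n
  proof (induction n arbitrary: a b rule: less_induct)
    case (less n)
    have 0: "fps_nth (z * f a b) k = 0" if "k \<le> n" for k a b
      using less that by (cases k) simp_all
    have "fps_nth (lam ^ a * g) n = 0" if "\<And>k. k \<le> n \<Longrightarrow> fps_nth g k = 0" for g
      using that by (simp add: fps_mult_nth)
    then have "fps_nth (lam ^ a * (z * f (Suc b) 0)) n = 0" using 0 by blast
    then show ?case by (subst f) (simp only: fps_add_nth 0[OF order.refl])
  qed
  then show ?thesis by (simp add: fps_eq_iff)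
qed

text \<open>Comparing coefficients of \<open>lam ^ (a + b)\<close> gives \<open>cC\<close> the
  factor \<open>1 - 2 * z * lam\<close>, which is \<open>(1 - 3 * z) * lam\<close>.\<close>

definition nu :: "rat fps" where "nu = inverse (1 - 3 * z)"

lemma nu: "nu * (1 - 3 * z) = 1"
  unfolding nu_def by (rule inverse_mult_eq_1) simp

text \<open>
  The coefficients of the solution \<open>lam ^ a * (cA + cB * b + cC * lam ^ b) + cD * a + cE * b + cK\<close>
  of the recurrence \<open>gf_W\<close>, obtained by comparing coefficients. They still depend on the unknown
  values at \<open>(0, 0)\<close> and \<open>(1, 0)\<close>, which turns the recurrence into a linear system for these two.
\<close>

definition cD :: "rat fps" where "cD = lam ^ 2 * z ^ 2 * F2"
definition cE :: "rat fps" where "cE = lam * (z * (F2 - z * lam ^ 2 * F0))"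
definition cK :: "rat fps" where "cK = lam * (z * cE - z * lam * F1)"
definition cB :: "rat fps" where "cB = lam * (z * lam * (F1 - F0) + z * cD)"
definition cA :: "rat fps" where
  "cA = lam * (z * cB + 1 - F0 + z * cK + z * lam * (F1 - F0) + z * cD)"
definition cC :: "rat fps" where "cC = nu * (F0 + z * cA)"

lemma solve_linear': "r = lam * c \<Longrightarrow> r = c + z * r"
  using z_lam by algebra

text \<open>Both sides solve the same inhomogeneous recurrence, so their difference solves the
  homogeneous one and vanishes.\<close>

lemma gf_W_explicit:
  "gf (W a b) = lam ^ a * (cA + cB * of_nat b + cC * lam ^ b) + of_nat a * cD + cE * of_nat b + cK"
proof -
  define w where "w a b =
    lam ^ a * (cA + cB * of_nat b + cC * lam ^ b) + of_nat a * cD + cE * of_nat b + cK" for a b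
  have D: "lam * z ^ 2 * F2 + z * cD - cD = 0"
    using solve_linear'[of cD "lam * z ^ 2 * F2"] by (simp add: cD_def power2_eq_square mult.assoc)
  have E: "z * (F2 - z * lam ^ 2 * F0) + z * cE - cE = 0"
    using solve_linear'[OF cE_def] by simp
  have K: "z * cE - z * lam * F1 + z * cK - cK = 0"
    using solve_linear'[OF cK_def] by simp
  have B: "z * lam * (F1 - F0) + z * cD + z * cB - cB = 0"
    using solve_linear'[OF cB_def] by simp
  have A: "z * cB + 1 - F0 + z * cK + z * lam * (F1 - F0) + z * cD + z * cA - cA = 0"
    using solve_linear'[OF cA_def] by simp
  have "cC * (1 - 3 * z) = F0 + z * cA"
    unfolding cC_def using nu by algebra
  then have C: "z * lam * cC + lam * (F0 + z * (cA + cC)) - cC = 0"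
    using z_lam by algebra
  have w: "w a b = z * w a (Suc b)
      + lam ^ a * (1 - F0 + of_nat (Suc b) * z * lam * (F1 - F0) + lam ^ Suc b * F0 + z * w (Suc b) 0)
      + of_nat a * lam * z ^ 2 * F2 + of_nat b * z * (F2 - z * lam ^ 2 * F0) - z * lam * F1" (is "_ = ?r") for a b
  proof -
    \<comment> \<open>One bracket for each of the six functions \<open>lam ^ a\<close>,
      \<open>lam ^ a * b\<close>, \<open>lam ^ (a + b)\<close>, \<open>a\<close>, \<open>b\<close>
      and 1; each vanishes by the choice of the coefficients.\<close>
    have "?r - w a b =
        lam ^ a * (z * cB + 1 - F0 + z * cK + z * lam * (F1 - F0) + z * cD + z * cA - cA)
        + lam ^ a * of_nat b * (z * lam * (F1 - F0) + z * cD + z * cB - cB)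
        + lam ^ a * lam ^ b * (z * lam * cC + lam * (F0 + z * (cA + cC)) - cC)
        + of_nat a * (lam * z ^ 2 * F2 + z * cD - cD)
        + of_nat b * (z * (F2 - z * lam ^ 2 * F0) + z * cE - cE)
        + (z * cE - z * lam * F1 + z * cK - cK)"
      unfolding w_def by (simp add: algebra_simps)
    then show ?thesis unfolding A B C D E K by simp
  qed
  have "gf (W a b) - w a b = 0"
  proof (rule recurrence_unique[of "\<lambda>a b. gf (W a b) - w a b"])
    show "gf (W a b) - w a b = z * (gf (W a (Suc b)) - w a (Suc b))
        + lam ^ a * (z * (gf (W (Suc b) 0) - w (Suc b) 0))" for a b
      by (subst gf_W, subst w) (simp add: zeta_def algebra_simps)
  qed
  then show ?thesis by (simp add: w_def)
qed

lemma F0_eq: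
  "F0 * (1 - 11*z + 51*z^2 - 132*z^3 + 209*z^4 - 208*z^5 + 128*z^6 - 44*z^7 + 5*z^8) =
    (1 - z)^4 * (1 - 6*z + 12*z^2 - 9*z^3 + z^4)"
proof (rule linear_system_solution[of z F2 F1 cD cE F0 cK cB cA cC "gf (W 1 0)"])
  have nonzero: "f \<noteq> 0" if "fps_nth f 0 = 1" for f :: "rat fps" using that by auto
  show "1 - z \<noteq> 0" "1 - 2 * z \<noteq> 0" "1 - 3 * z \<noteq> 0" "1 - 4 * z + 6 * z^2 - 5 * z^3 + z^4 \<noteq> 0"
    by (rule nonzero, simp)+
  \<comment> \<open>Solving \<open>gf_P_1\<close> divides by \<open>1 - z * lam\<close>, which is
    \<open>(1 - 2 * z) * lam\<close>; this is where the factor \<open>1 - 2 * z\<close> comes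
    from.\<close>
  have "F2 = lam * z * gf (P 1)" using gf_P_1 by (simp add: F2_def algebra_simps)
  then show "F2 * ((1 - z) * (1 - 2 * z)) = z * F1"
    using gf_P_1 z_lam by algebra
  show "cD * (1 - z)^2 = z^2 * F2"
    unfolding cD_def using z_lam by algebra
  show "cE * (1 - z)^3 = z * (1 - z)^2 * F2 - z^2 * F0"
    unfolding cE_def using z_lam by algebra
  show "cK * (1 - z)^2 = z * (1 - z) * cE - z * F1"
    unfolding cK_def using z_lam by algebra
  show "cB * (1 - z)^2 = z * (F1 - F0) + z * (1 - z) * cD"
    unfolding cB_def using z_lam by algebra
  show "cA * (1 - z)^2 = z * (1 - z) * cB + (1 - z) - (1 - z) * F0 + z * (1 - z) * cK + z * (F1 - F0)
      + z * (1 - z) * cD"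
    unfolding cA_def using z_lam by algebra
  show "cC * (1 - 3 * z) = F0 + z * cA"
    unfolding cC_def using nu by algebra
  show "F0 = 1 + z * (cA + cC + cK)"
    using gf_W_explicit[of 0 0] by (simp add: F0_def)
  have "gf (W 1 0) = lam * (cA + cC) + cD + cK"
    using gf_W_explicit[of 1 0] by simp
  then show "gf (W 1 0) * (1 - z) = cA + cC + (1 - z) * cD + (1 - z) * cK"
    using z_lam by algebra
  show "F1 = 1 + z * gf (W 1 0)" by (rule F1_def)
qed

lemma avoiders_gf_patterns: "avoiders_gf patterns = F0"
proof (rule fps_ext)
  fix n
  show "fps_nth (avoiders_gf patterns) n = fps_nth F0 n"
    by (cases n) (simp_all add: avoiders_gf_def F0_def gf_def card_avoiders_0 card_avoiders_Suc)
qed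

theorem theorem3p49:
  fixes T :: "nat list set" and x :: "rat fps"
  defines "T \<equiv> {[1,4,3,2], [2,1,4,3], [3,2,1,4]}"
    and "x \<equiv> fps_X"
  shows "avoiders_gf T =
    ((1 - x)^4 * (1 - 6*x + 12*x^2 - 9*x^3 + x^4)) /
    (1 - 11*x + 51*x^2 - 132*x^3 + 209*x^4 - 208*x^5 + 128*x^6 - 44*x^7 + 5*x^8)"
proof -
  let ?d = "1 - 11*z + 51*z^2 - 132*z^3 + 209*z^4 - 208*z^5 + 128*z^6 - 44*z^7 + 5*z^8"
  have "fps_nth ?d 0 = 1" by simp
  \<comment> \<open>A nonzero denominator is enough to cancel it in the division of power
    series.\<close>
  then have "?d \<noteq> 0" by (metis fps_zero_nth zero_neq_one)
  then have "F0 = (F0 * ?d) / ?d" by simp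
  then show ?thesis
    unfolding F0_eq T_def x_def patterns_def[symmetric] avoiders_gf_patterns .
qed

end
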